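(* Let $q\ge2$ be a prime power and $V$ an $n$-dimensional vector space over $\mathbb{F}_q$. Let $n,k,t,s$ be positive integers with $(k,t)\ne(4,2)$, $k\ge t+2$ and $n\ge 3k+3t+1+\log_q(13s)$. Suppose that $\mathcal{F},\mathcal{G}\subseteq{V\brack k}$ are $s$-almost cross-$t$-intersecting with $\dim\left(\bigcap_{H\in\mathcal{F}\cup\mathcal{G}}H\right)<t$, that $|\mathcal{F}||\mathcal{G}|$ is maximum among all such pairs of families (i.e. among all pairs of $s$-almost cross-$t$-intersecting families in ${V\brack k}$ whose members have intersection of dimension less than $t$), and that $|\mathcal{F}|\le|\mathcal{G}|$. Then: (i) If $k\le 2t$, then $|\mathcal{F}||\mathcal{G}|\le g_2(n,k,t)$, and equality holds only if there exists $L\in{V\brack t+1}$ such that $\mathcal{F}=\mathcal{H}_1(V,L;k)$ and $\mathcal{G}=\mathcal{M}(L;k,t)$. (ii) If $k\ge 2t+1$, then $|\mathcal{F}||\mathcal{G}|\le g_1(n,k,t,s)$, and equality holds only if there exist $X\in{V\brack k+1}$ and $E\in{X\brack t}$ such that $\mathcal{F}=\mathcal{H}_1(V,E;k)\setminus\mathcal{A}$ and $\mathcal{G}=\mathcal{H}_1(V,E;k)\cup\mathcal{B}$, where $\mathcal{A}\subseteq\mathcal{H}_2(X,E;k)$ and $\mathcal{B}\subseteq{X\brack k}\setminus\mathcal{H}_1(X,E;k)$ with $|\mathcal{A}|=q^{(k-t)(k-t+1)}{n-k-1\brack k-t}-s$ and $|\mathcal{B}|=\min\{s,q^{k-t+1}{t\brack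 1}\}$.
   Context: ${V\brack k}$ (resp. ${X\brack k}$) denotes the set of $k$-dimensional subspaces of $V$ (resp. of a subspace $X$). Gaussian binomial: ${a\brack b}=\prod_{0\le i<b}\frac{q^{a-i}-1}{q^{b-i}-1}$, ${a\brack 0}=1$, ${a\brack b}=0$ for $b<0$. For a family $\mathcal{G}$ and subspace $F$, $\mathcal{D}_{\mathcal{G}}(F;t)=\{G\in\mathcal{G}:\dim(G\cap F)<t\}$. $\mathcal{F},\mathcal{G}\subseteq{V\brack k}$ are $s$-almost cross-$t$-intersecting if $|\mathcal{D}_{\mathcal{G}}(F;t)|\le s$ for all $F\in\mathcal{F}$ and $|\mathcal{D}_{\mathcal{F}}(G;t)|\le s$ for all $G\in\mathcal{G}$. For subspaces $E\subseteq X$ of $V$ and a subspace $L$: $\mathcal{H}_1(X,E;k)=\{F\in{X\brack k}:E\subseteq F\}$, $\mathcal{H}_2(X,E;k)=\{F\in{V\brack k}:F\cap X=E\}$, $\mathcal{M}(L;k,t)=\{F\in{V\brack k}:\dim(F\cap L)\ge t\}$. Define $g_1(n,k,t,s)=\left({n-t\brack k-t}-q^{(k-t)(k+1-t)}{n-k-1\brack k-t}+s\right)\left({n-t\brack k-t}+\min\{s,q^{k-t+1}{t\brack 1}\}\right)$ and $g_2(n,k,t)=q^{k-t}{t+1\brack 1}{n-t-1\brack k-t-1}{n-t-1\brack k-t}+{n-t-1\brack k-t-1}^2$. *)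

theory Defs
  imports Complex_Main "HOL-Library.Cardinality"
begin

(* The ambient vector space V is the whole type 'b, with an explicit scalar multiplication
   scale of the finite field 'a on it, so V = UNIV. *)

definition subspaces_of_dim ::
  "('a::field \<Rightarrow> 'b::ab_group_add \<Rightarrow> 'b) \<Rightarrow> 'b set \<Rightarrow> nat \<Rightarrow> 'b set set" where
  "subspaces_of_dim scale X k =
     {U. module.subspace scale U \<and> U \<subseteq> X \<and> vector_space.dim scale U = k}"

(* Integer arguments, so that differences such as n - t - 1 are not truncated. The product
   is empty for b = 0; for 0 \<le> a < b the factor i = a has numerator 0. *)
definition gauss_binomial :: "nat \<Rightarrow> int \<Rightarrow> int \<Rightarrow> real" where
  "gauss_binomial q a b =
     (if b < 0 then 0
      else \<Prod>i\<in>{0..<b}. (real q powi (a - i) - 1) / (real q powi (b - i) - 1))"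

definition D_fam ::
  "('a::field \<Rightarrow> 'b::ab_group_add \<Rightarrow> 'b) \<Rightarrow> 'b set set \<Rightarrow> 'b set \<Rightarrow> nat \<Rightarrow> 'b set set" where
  "D_fam scale \<G> F t = {G\<in>\<G>. vector_space.dim scale (G \<inter> F) < t}"

definition almost_cross_intersecting ::
  "('a::field \<Rightarrow> 'b::ab_group_add \<Rightarrow> 'b) \<Rightarrow> nat \<Rightarrow> nat \<Rightarrow> nat \<Rightarrow> 'b set set \<Rightarrow> 'b set set \<Rightarrow> bool" where
  "almost_cross_intersecting scale k t s \<F> \<G> \<longleftrightarrow>
     \<F> \<subseteq> subspaces_of_dim scale UNIV k \<and> \<G> \<subseteq> subspaces_of_dim scale UNIV k \<and>
     (\<forall>F\<in>\<F>. card (D_fam scale \<G> F t) \<le> s) \<and>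
     (\<forall>G\<in>\<G>. card (D_fam scale \<F> G t) \<le> s)"

(* If both families are empty, the intersection is UNIV = V. *)
definition nontrivial_pair ::
  "('a::field \<Rightarrow> 'b::ab_group_add \<Rightarrow> 'b) \<Rightarrow> nat \<Rightarrow> 'b set set \<Rightarrow> 'b set set \<Rightarrow> bool" where
  "nontrivial_pair scale t \<F> \<G> \<longleftrightarrow> vector_space.dim scale (\<Inter>(\<F> \<union> \<G>)) < t"

definition H1 ::
  "('a::field \<Rightarrow> 'b::ab_group_add \<Rightarrow> 'b) \<Rightarrow> 'b set \<Rightarrow> 'b set \<Rightarrow> nat \<Rightarrow> 'b set set" where
  "H1 scale X E k = {F\<in>subspaces_of_dim scale X k. E \<subseteq> F}"

definition H2 ::
  "('a::field \<Rightarrow> 'b::ab_group_add \<Rightarrow> 'b) \<Rightarrow> 'b set \<Rightarrow> 'b set \<Rightarrow> nat \<Rightarrow> 'b set set" where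
  "H2 scale X E k = {F\<in>subspaces_of_dim scale UNIV k. F \<inter> X = E}"

definition M_fam ::
  "('a::field \<Rightarrow> 'b::ab_group_add \<Rightarrow> 'b) \<Rightarrow> 'b set \<Rightarrow> nat \<Rightarrow> nat \<Rightarrow> 'b set set" where
  "M_fam scale L k t =
     {F\<in>subspaces_of_dim scale UNIV k. t \<le> vector_space.dim scale (F \<inter> L)}"

(* The natural-number differences in the exponents of q below are genuine for t \<le> k. *)
definition g1 :: "nat \<Rightarrow> nat \<Rightarrow> nat \<Rightarrow> nat \<Rightarrow> nat \<Rightarrow> real" where
  "g1 q n k t s =
     (gauss_binomial q (int n - int t) (int k - int t)
        - real q ^ ((k - t) * (k + 1 - t)) * gauss_binomial q (int n - int k - 1) (int k - int t)
        + real s)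
     * (gauss_binomial q (int n - int t) (int k - int t)
        + min (real s) (real q ^ (k - t + 1) * gauss_binomial q (int t) 1))"

definition g2 :: "nat \<Rightarrow> nat \<Rightarrow> nat \<Rightarrow> nat \<Rightarrow> real" where
  "g2 q n k t =
     real q ^ (k - t) * gauss_binomial q (int t + 1) 1
       * gauss_binomial q (int n - int t - 1) (int k - int t - 1)
       * gauss_binomial q (int n - int t - 1) (int k - int t)
     + (gauss_binomial q (int n - int t - 1) (int k - int t - 1))\<^sup>2"

end

theory Submission
  imports Defs
begin

text \<open>
  Let \<open>B\<^sub>i\<close> be the number of \<open>k\<close>-spaces through a fixed space of dimension \<open>t + i\<close>, and \<open>c\<close> the number
  of one-dimensional subspaces of a space of dimension \<open>k - t + 1\<close>. If \<open>S\<close> meets some \<open>G \<in> \<G>\<close> in dimension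
  less than \<open>t\<close>, then all but \<open>s\<close> members of \<open>\<F>\<close> through \<open>S\<close> contain one of at most \<open>c\<close> spaces that
  extend \<open>S\<close> by one dimension. Iterating this up to the least dimension \<open>t + j\<close> of a space \<open>T\<close> with
  \<open>dim (G \<inter> T) \<ge> t\<close> for all \<open>G \<in> \<G>\<close> bounds \<open>\<F>\<close> locally, and \<open>T\<close> in turn bounds \<open>\<G>\<close>. For large \<open>n\<close> the
  product is then negligible against \<open>B\<^sub>0 B\<^sub>1\<close> unless one family has a common \<open>t\<close>-space \<open>E\<close> and the other
  one has \<open>j = 1\<close>. There, either the first family has a common \<open>(t + 1)\<close>-space, which gives \<open>g\<^sub>2\<close>, or all
  members of the second family not containing \<open>E\<close> lie in one \<open>(k + 1)\<close>-space \<open>X \<supseteq> E\<close>, which gives \<open>g\<^sub>1\<close>.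
  Finally \<open>g\<^sub>1\<close> and \<open>g\<^sub>2\<close> are compared; for \<open>k = 2 t\<close> their leading terms agree and the second-order
  terms decide.
\<close>

section \<open>Gaussian binomials\<close>

text \<open>The size of one family is governed by the cover level of the other, so neither can be
  estimated alone; when both lack a common t-space, only their product can be regrouped into factors
  that depend on a single level. In units of \<open>B 0 * B 1\<close> the extremal products have
  leading coefficients \<open>c\<close> and \<open>qint q (t + 1)\<close>, the numbers of points of
  spaces of dimension \<open>k - t + 1\<close> and \<open>t + 1\<close>. Distinct dimensions
  separate these by a factor of at least 2, so crude constants suffice except at
  \<open>k = 2 * t\<close>. There the difference has the order of \<open>B 0 * B 2\<close>, and the
  summand \<open>s\<close> of \<open>g1\<close> has to be absorbed by a multiple of
  \<open>B 2\<close>; for \<open>(k, t) = (4, 2)\<close> one has \<open>B 2 = 1\<close> and this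
  fails. The lower bound on \<open>n\<close> makes \<open>q ^ (n - k)\<close>, which bounds the
  ratios \<open>B i / B (i + 1)\<close> from below, exceed constants times powers up to about
  \<open>q ^ (2 * k + 2 * t + 2)\<close>: one such ratio pays for an extension step and a choice of
  a t-space in a cover, once for each family.\<close>

definition gb :: "real \<Rightarrow> nat \<Rightarrow> nat \<Rightarrow> real" where
  "gb q a b = (\<Prod>i<b. q ^ (a - i) - 1) / (\<Prod>i<b. q ^ Suc i - 1)"

lemma gb_0 [simp]: "gb q a 0 = 1"
  by (simp add: gb_def)

definition qint :: "real \<Rightarrow> nat \<Rightarrow> real" where
  "qint q a = (q ^ a - 1) / (q - 1)"

lemma gb_1: "gb q a (Suc 0) = qint q a"
  by (simp add: gb_def qint_def)

lemma gb_Suc_Suc: "gb q (Suc a) (Suc b) = gb q a b * ((q ^ Suc a - 1) / (q ^ Suc b - 1))"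
proof -
  have "(\<Prod>i<Suc b. q ^ (Suc a - i) - 1) = (q ^ Suc a - 1) * (\<Prod>i<b. q ^ (a - i) - 1)"
    by (subst prod.lessThan_Suc_shift) simp
  thus ?thesis by (simp add: gb_def)
qed

lemma gb_Suc_right: "gb q a (Suc b) = gb q a b * ((q ^ (a - b) - 1) / (q ^ Suc b - 1))"
  by (simp add: gb_def)

lemma power_minus_1_pos: "1 < (q::real) \<Longrightarrow> 0 < q ^ Suc i - 1"
  using one_less_power[of q "Suc i"] by simp

lemma gb_pos:
  assumes "1 < q" "b \<le> a" shows "0 < gb q a b"
  unfolding gb_def
proof (intro divide_pos_pos prod_pos ballI)
  fix i assume "i \<in> {..<b}"
  hence "a - i = Suc (a - i - 1)" using assms(2) by simp
  thus "0 < q ^ (a - i) - 1" using power_minus_1_pos[OF assms(1), of "a - i - 1"] by simp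
qed (rule power_minus_1_pos[OF assms(1)])

lemma gb_nonneg:
  assumes "1 < q" shows "0 \<le> gb q a b"
  unfolding gb_def
  by (intro divide_nonneg_nonneg prod_nonneg ballI) (use assms in \<open>auto simp: one_le_power\<close>,
      use power_minus_1_pos[OF assms] in \<open>force intro: less_imp_le\<close>)

lemma gb_eq_0:
  assumes "a < b" shows "gb q a b = 0"
  unfolding gb_def using assms by (intro divide_eq_0_iff[THEN iffD2] disjI1 prod_zero) (auto intro!: bexI[of _ a])

lemma gb_Pascal:
  assumes "1 < q" "b \<le> a"
  shows "gb q (Suc a) (Suc b) = q ^ Suc b * gb q a (Suc b) + gb q a b"
proof -
  have p: "q ^ Suc b - 1 \<noteq> 0" using power_minus_1_pos[OF assms(1), of b] by simp
  have "q ^ Suc b * q ^ (a - b) = q ^ Suc a" using assms(2) by (simp flip: power_add)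
  hence "q ^ Suc b * (q ^ (a - b) - 1) + (q ^ Suc b - 1) = q ^ Suc a - 1"
    by (simp add: algebra_simps)
  hence "gb q a b * ((q ^ Suc a - 1) / (q ^ Suc b - 1))
      = gb q a b * ((q ^ Suc b * (q ^ (a - b) - 1) + (q ^ Suc b - 1)) / (q ^ Suc b - 1))"
    by simp
  also have "\<dots> = q ^ Suc b * (gb q a b * ((q ^ (a - b) - 1) / (q ^ Suc b - 1))) + gb q a b"
    using p by (simp add: add_divide_distrib distrib_left)
  finally show ?thesis by (simp only: gb_Suc_Suc[of q a b] gb_Suc_right[of q a b])
qed

lemma gb_Suc_self:
  assumes "1 < q" shows "gb q (Suc a) a = qint q (Suc a)"
proof (induction a)
  case (Suc a)
  have "gb q (Suc (Suc a)) (Suc a) = gb q (Suc a) a * ((q ^ Suc (Suc a) - 1) / (q ^ Suc a - 1))"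
    by (rule gb_Suc_Suc)
  also have "\<dots> = qint q (Suc (Suc a))"
    using power_minus_1_pos[OF assms, of a] assms by (simp add: Suc qint_def)
  finally show ?case .
qed (use assms in \<open>simp add: qint_def\<close>)

lemma qint_nonneg: "1 < q \<Longrightarrow> 0 \<le> qint q a"
  by (simp add: qint_def one_le_power)

lemma qint_Suc:
  assumes "1 < q" shows "qint q (Suc a) = q * qint q a + 1"
  using assms by (simp add: qint_def field_simps)

lemma qint_Suc':
  assumes "1 < q" shows "qint q (Suc a) = q ^ a + qint q a"
  using assms by (simp add: qint_def field_simps)

lemma qint_le_power:
  assumes "2 \<le> q" shows "qint q a \<le> q ^ a"
proof (induction a)
  case (Suc a)
  have "2 * q ^ a \<le> q * q ^ a" by (intro mult_right_mono) (use assms in auto)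
  thus ?case using Suc qint_Suc'[of q a] assms by (simp only: power_Suc)
qed (simp add: qint_def)

lemma power_le_qint_Suc:
  assumes "1 < q" shows "q ^ a \<le> qint q (Suc a)"
  using qint_Suc'[OF assms, of a] qint_nonneg[OF assms, of a] by simp

lemma qint_mono:
  assumes "1 < q" "a \<le> b" shows "qint q a \<le> qint q b"
  using assms by (auto simp: qint_def intro!: divide_right_mono power_increasing)

text \<open>Each of the \<open>b\<close> factors of the product is at most
  \<open>q ^ (j + 1)\<close>; the extra power of \<open>q\<close> over the true order
  \<open>q ^ j\<close> absorbs the subtracted ones.\<close>

lemma gb_le_power:
  assumes "2 \<le> q" shows "gb q (b + j) b \<le> q ^ (b * (j + 1))"
proof (induction b)
  case (Suc b)
  have p: "0 < q ^ Suc b - 1" using power_minus_1_pos[of q b] assms by simp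
  have "q ^ Suc (b + j) - 1 \<le> q ^ (j + 1) * (q ^ Suc b - 1)"
  proof -
    have "2 * q ^ Suc (b + j) \<le> q * q ^ Suc (b + j)" by (intro mult_right_mono) (use assms in auto)
    moreover have "q ^ (j + 1) \<le> q ^ Suc (b + j)" by (intro power_increasing) (use assms in auto)
    moreover have "q ^ (j + 1) * q ^ Suc b = q * q ^ Suc (b + j)" by (simp add: power_add)
    ultimately show ?thesis by (simp only: right_diff_distrib)
  qed
  hence "(q ^ Suc (b + j) - 1) / (q ^ Suc b - 1) \<le> q ^ (j + 1)"
    using p by (simp add: pos_divide_le_eq)
  hence "gb q (b + j) b * ((q ^ Suc (b + j) - 1) / (q ^ Suc b - 1)) \<le> q ^ (b * (j + 1)) * q ^ (j + 1)"
    using Suc p power_minus_1_pos[of q "b + j"] assms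
    by (intro mult_mono) (auto intro!: divide_nonneg_pos less_imp_le)
  thus ?case by (simp add: gb_Suc_Suc power_add mult_ac)
qed simp

text \<open>Source of all decay estimates. The exponent \<open>a - b\<close> does not change when
  both arguments are lowered together, so one and the same power bounds every ratio of consecutive
  counts.\<close>

lemma gb_ratio:
  assumes "1 < q" "b \<le> a"
  shows "q ^ (a - b) * gb q a b \<le> gb q (Suc a) (Suc b)"
proof -
  have p: "0 < q ^ Suc b - 1" using power_minus_1_pos[OF assms(1), of b] .
  have "q ^ (a - b) * (q ^ Suc b - 1) \<le> q ^ Suc a - 1"
  proof -
    have "q ^ (a - b) * q ^ Suc b = q ^ Suc a" using assms(2) by (simp flip: power_add)
    moreover have "1 \<le> q ^ (a - b)" using assms(1) by (intro one_le_power) simp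
    ultimately show ?thesis by (simp only: right_diff_distrib)
  qed
  hence "q ^ (a - b) \<le> (q ^ Suc a - 1) / (q ^ Suc b - 1)" using p by (simp add: pos_le_divide_eq)
  hence "gb q a b * q ^ (a - b) \<le> gb q a b * ((q ^ Suc a - 1) / (q ^ Suc b - 1))"
    by (intro mult_left_mono gb_nonneg assms)
  thus ?thesis by (simp add: gb_Suc_Suc mult.commute)
qed

text \<open>The left side counts ordered extensions of an \<open>x\<close>-space by \<open>m\<close>
  vectors inside a \<open>w\<close>-space, the last factor those of an \<open>e\<close>-space inside
  an \<open>(e + m)\<close>-space. Their quotient is the number sought in
  \<open>card_subspaces_Int_eq\<close>.\<close>

lemma prod_power_diff_eq_gb:
  assumes "1 < (q::real)" "e \<le> x" "x \<le> w"
  shows "(\<Prod>i<m. q ^ w - q ^ (x + i))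
    = q ^ (m * (x - e)) * gb q (w - x) m * (\<Prod>i<m. q ^ (e + m) - q ^ (e + i))"
proof (cases "w - x < m")
  case True
  hence "(\<Prod>i<m. q ^ w - q ^ (x + i)) = 0"
    using assms(3) by (intro prod_zero) (auto intro!: bexI[of _ "w - x"])
  thus ?thesis using True by (simp add: gb_eq_0)
next
  case False
  have 1: "(\<Prod>i<m. q ^ w - q ^ (x + i)) = (\<Prod>i<m. q ^ (x + i)) * (\<Prod>i<m. q ^ (w - x - i) - 1)"
    unfolding prod.distrib[symmetric]
    by (intro prod.cong refl) (use False assms(3) in \<open>simp add: right_diff_distrib flip: power_add\<close>)
  have 2: "(\<Prod>i<m. q ^ (e + m) - q ^ (e + i)) = (\<Prod>i<m. q ^ (e + i)) * (\<Prod>i<m. q ^ (m - i) - 1)"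
    unfolding prod.distrib[symmetric]
    by (intro prod.cong refl) (simp add: right_diff_distrib flip: power_add)
  have 3: "(\<Prod>i<m. q ^ (m - i) - 1) = (\<Prod>i<m. q ^ Suc i - 1)"
    by (subst prod.nat_diff_reindex[symmetric]) (auto intro!: prod.cong)
  have 4: "(\<Prod>i<m. q ^ (x + i)) = q ^ (m * (x - e)) * (\<Prod>i<m. q ^ (e + i))"
  proof -
    have "(\<Prod>i<m. q ^ (x + i)) = (\<Prod>i<m. q ^ (x - e) * q ^ (e + i))"
      using assms(2) by (intro prod.cong) (auto simp flip: power_add)
    thus ?thesis by (simp add: prod.distrib mult.commute flip: power_mult)
  qed
  have "(\<Prod>i<m. q ^ Suc i - 1) \<noteq> 0"
    using power_minus_1_pos[OF assms(1)] by (intro prod_pos[THEN less_imp_neq, symmetric]) auto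
  thus ?thesis by (simp add: 1 2 3 4 gb_def)
qed

lemma gauss_binomial_eq_gb:
  assumes "b \<le> a" shows "gauss_binomial q (int a) (int b) = gb (real q) a b"
proof -
  have powi: "real q powi (int a - int i) = real q ^ (a - i)" if "i \<le> a" for a i :: nat
    using that by (simp add: power_int_def nat_diff_distrib')
  have "gauss_binomial q (int a) (int b)
      = (\<Prod>i<b. (real q powi (int a - int i) - 1) / (real q powi (int b - int i) - 1))"
    unfolding gauss_binomial_def
    by (simp, rule prod.reindex_bij_witness[of _ int nat]) auto
  also have "\<dots> = (\<Prod>i<b. (real q ^ (a - i) - 1) / (real q ^ (b - i) - 1))"
    using assms by (intro prod.cong) (auto simp: powi)
  also have "(\<Prod>i<b. real q ^ (b - i) - 1) = (\<Prod>i<b. real q ^ Suc i - 1)"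
    by (subst prod.nat_diff_reindex[symmetric]) (auto intro!: prod.cong)
  hence "(\<Prod>i<b. (real q ^ (a - i) - 1) / (real q ^ (b - i) - 1)) = gb (real q) a b"
    by (simp add: prod_dividef gb_def)
  finally show ?thesis .
qed

text \<open>Turns equality in a product of two upper bounds into equality in both, which is how the
  extremal families are identified.\<close>

lemma mult_eq_imp_eq:
  fixes a b x y :: real
  assumes "0 \<le> x" "x \<le> a" "0 \<le> y" "y \<le> b" "0 < a" "0 < b" "a * b \<le> x * y"
  shows "x = a" "y = b"
proof -
  have "x * y \<le> a * y" "a * y \<le> a * b" using assms by (intro mult_right_mono mult_left_mono; simp)+
  hence "a * y = a * b" "x * y = a * y" using assms(7) by linarith+
  thus "y = b" "x = a" using assms(5,6) by auto
qed

section \<open>Counting subspaces over a finite field\<close>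

locale finite_field_vector_space = finite_dimensional_vector_space scale Basis
  for scale :: "'a::{field,finite} \<Rightarrow> 'b::ab_group_add \<Rightarrow> 'b" and Basis :: "'b set" +
  fixes q :: nat
  assumes q_eq: "q = CARD('a)"
begin

lemma q_ge_2: "2 \<le> q"
  unfolding q_eq using card_mono[of "UNIV :: 'a set" "{0, 1}"] by simp

lemma real_q_ge_2: "2 \<le> real q"
  using q_ge_2 by simp

lemma real_q_gt_1: "1 < real q"
  using q_ge_2 by simp

lemma finite_span:
  assumes "finite B" shows "finite (span B)"
  using assms
proof (induction B)
  case (insert a B)
  have "span (insert a B) \<subseteq> (\<lambda>(k, y). scale k a + y) ` (UNIV \<times> span B)"
  proof
    fix x assume "x \<in> span (insert a B)"
    then obtain k where "x - scale k a \<in> span B" by (auto simp: span_insert)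
    thus "x \<in> (\<lambda>(k, y). scale k a + y) ` (UNIV \<times> span B)"
      by (intro image_eqI[of _ _ "(k, x - scale k a)"]) auto
  qed
  moreover have "finite ((\<lambda>(k, y). scale k a + y) ` ((UNIV :: 'a set) \<times> span B))"
    using insert.IH by (intro finite_imageI finite_cartesian_product finite)
  ultimately show ?case by (rule finite_subset)
qed simp

lemma finite_vectors [simp]: "finite (A :: 'b set)"
  by (rule finite_subset[OF _ finite_span[OF finite_Basis]]) (simp add: span_Basis)

lemma finite_families [simp]: "finite (A :: 'b set set)"
  by (rule finite_subset[of A "Pow UNIV"], simp, simp only: finite_Pow_iff finite_vectors)

lemma card_span_independent:
  assumes "independent B" shows "card (span B) = q ^ card B"
  using finite_vectors[of B] assms
proof (induction B)
  case (insert a B)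
  have ind: "independent B" "a \<notin> span B"
    using insert.prems insert.hyps by (auto simp: independent_insert)
  let ?f = "\<lambda>(k, y). scale k a + y"
  have "span (insert a B) = ?f ` (UNIV \<times> span B)"
  proof (intro equalityI subsetI)
    fix x assume "x \<in> span (insert a B)"
    then obtain k where "x - scale k a \<in> span B" by (auto simp: span_insert)
    thus "x \<in> ?f ` (UNIV \<times> span B)" by (intro image_eqI[of _ _ "(k, x - scale k a)"]) auto
  next
    fix x assume "x \<in> ?f ` (UNIV \<times> span B)"
    then obtain k y where "x = scale k a + y" "y \<in> span B" by auto
    thus "x \<in> span (insert a B)" by (auto simp: span_insert intro!: exI[of _ k])
  qed
  moreover have "inj_on ?f (UNIV \<times> span B)"
  proof (rule inj_onI, clarify)
    fix k y l z assume *: "y \<in> span B" "z \<in> span B" "scale k a + y = scale l a + z"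
    have "scale (k - l) a = z - y" using *(3) by (simp add: algebra_simps)
    hence "scale (k - l) a \<in> span B" using * span_diff by simp
    hence "scale (inverse (k - l)) (scale (k - l) a) \<in> span B" by (rule span_scale)
    hence "k = l" using ind(2) by (cases "k = l") auto
    thus "k = l \<and> y = z" using *(3) by simp
  qed
  ultimately show ?case using insert ind by (simp add: card_image card_cartesian_product q_eq)
qed simp

lemma card_subspace:
  assumes "subspace U" shows "card U = q ^ dim U"
proof -
  obtain B where "B \<subseteq> U" "independent B" "U \<subseteq> span B" "card B = dim U" by (rule basis_exists)
  moreover from this have "span B = U" by (intro span_subspace assms)
  ultimately show ?thesis using card_span_independent by metis
qed

section \<open>Sequences of vectors independent modulo a subspace\<close>

lemma dim_span_insert:
  assumes "subspace X" "v \<notin> X" shows "dim (span (insert v X)) = Suc (dim X)"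
  using assms by (simp add: dim_insert flip: span_eq_iff)

text \<open>Sequential form of independence modulo \<open>X\<close>: for lists, the number of
  choices for the next vector depends only on its position, so the count needs neither bases nor
  quotient spaces.\<close>

primrec indep_over :: "'b set \<Rightarrow> 'b list \<Rightarrow> bool" where
  "indep_over X [] \<longleftrightarrow> True"
| "indep_over X (v # vs) \<longleftrightarrow> v \<notin> X \<and> indep_over (span (insert v X)) vs"

definition ext_lists :: "'b set \<Rightarrow> 'b set \<Rightarrow> nat \<Rightarrow> 'b list set" where
  "ext_lists X W m = {vs. length vs = m \<and> set vs \<subseteq> W \<and> indep_over X vs}"

lemma finite_ext_lists [simp]: "finite (ext_lists X W m)"
  by (rule finite_subset[OF _ finite_lists_length_eq[of W m]]) (auto simp: ext_lists_def)

lemma card_ext_lists: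
  assumes "subspace X" "subspace W" "X \<subseteq> W"
  shows "real (card (ext_lists X W m)) = (\<Prod>i<m. real q ^ dim W - real q ^ (dim X + i))"
  using assms
proof (induction m arbitrary: X)
  case 0
  have "ext_lists X W 0 = {[]}" by (auto simp: ext_lists_def)
  thus ?case by simp
next
  case (Suc m)
  have eq: "ext_lists X W (Suc m)
      = (\<Union>v\<in>W - X. (#) v ` ext_lists (span (insert v X)) W m)"
    by (auto simp: ext_lists_def length_Suc_conv)
  have card_eq: "card (ext_lists X W (Suc m)) = (\<Sum>v\<in>W - X. card (ext_lists (span (insert v X)) W m))"
    unfolding eq by (subst card_UN_disjoint) (auto simp: card_image)
  have "real (card (ext_lists X W (Suc m)))
      = (\<Sum>v\<in>W - X. \<Prod>i<m. real q ^ dim W - real q ^ (dim X + Suc i))"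
    unfolding card_eq of_nat_sum
  proof (intro sum.cong refl)
    fix v assume v: "v \<in> W - X"
    have "span (insert v X) \<subseteq> W" using v Suc.prems by (intro span_minimal) auto
    thus "real (card (ext_lists (span (insert v X)) W m))
      = (\<Prod>i<m. real q ^ dim W - real q ^ (dim X + Suc i))"
      using Suc.IH[of "span (insert v X)"] v Suc.prems
        dim_span_insert[of X v] by simp
  qed
  also have "\<dots> = (real q ^ dim W - real q ^ dim X) * (\<Prod>i<m. real q ^ dim W - real q ^ (dim X + Suc i))"
  proof -
    have "q ^ dim X \<le> q ^ dim W" using q_ge_2 dim_subset[OF Suc.prems(3)] by (intro power_increasing) auto
    hence "real (card (W - X)) = real q ^ dim W - real q ^ dim X"
      using Suc.prems by (simp add: card_Diff_subset card_subspace of_nat_diff)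
    thus ?thesis by simp
  qed
  also have "\<dots> = (\<Prod>i<Suc m. real q ^ dim W - real q ^ (dim X + i))"
    by (subst prod.lessThan_Suc_shift) simp
  finally show ?case .
qed

lemma span_insert_Int:
  assumes "subspace F" "subspace X" "v \<in> F"
  shows "F \<inter> span (insert v X) = span (insert v (F \<inter> X))"
proof (intro equalityI subsetI)
  fix y assume y: "y \<in> F \<inter> span (insert v X)"
  then obtain k where k: "y - scale k v \<in> span X" by (auto simp: span_insert)
  hence "y - scale k v \<in> F \<inter> X"
    using assms y by (auto simp: subspace_diff subspace_scale span_eq_iff[THEN iffD2])
  thus "y \<in> span (insert v (F \<inter> X))" unfolding span_insert by (auto intro: span_base)
next
  fix y assume y: "y \<in> span (insert v (F \<inter> X))"
  moreover have "span (insert v (F \<inter> X)) \<subseteq> F" using assms by (intro span_minimal) auto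
  moreover have "span (insert v (F \<inter> X)) \<subseteq> span (insert v X)" by (intro span_mono) auto
  ultimately show "y \<in> F \<inter> span (insert v X)" by auto
qed

text \<open>Adjoining \<open>v\<close> to \<open>E\<close> and to \<open>X\<close> at once keeps the
  statement inductive. The intersection can then be cut back from the enlarged \<open>X\<close> to
  \<open>X\<close>, since a vector of \<open>span (insert v E)\<close> with nonzero coefficient at
  \<open>v\<close> is not in \<open>X\<close>.\<close>

lemma ext_lists_span:
  assumes "subspace E" "subspace X" "E \<subseteq> X" "indep_over X vs"
  shows "dim (span (E \<union> set vs)) = dim E + length vs \<and> span (E \<union> set vs) \<inter> X = E"
  using assms
proof (induction vs arbitrary: E X)
  case Nil
  thus ?case by (auto simp: span_eq_iff[THEN iffD2])
next
  case (Cons v vs)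
  let ?E = "span (insert v E)" and ?X = "span (insert v X)"
  have EX: "?E \<subseteq> ?X" using Cons.prems by (intro span_mono) auto
  have IH: "dim (span (?E \<union> set vs)) = dim ?E + length vs" "span (?E \<union> set vs) \<inter> ?X = ?E"
    using Cons.IH[of ?E ?X] Cons.prems EX by auto
  have sp: "span (?E \<union> set vs) = span (E \<union> set (v # vs))"
  proof (intro equalityI span_minimal)
    show "?E \<union> set vs \<subseteq> span (E \<union> set (v # vs))"
      using span_mono[of "insert v E" "E \<union> set (v # vs)"] by (auto intro: span_base)
    show "E \<union> set (v # vs) \<subseteq> span (?E \<union> set vs)" by (auto intro!: span_base)
  qed auto
  have vE: "v \<notin> E" using Cons.prems by auto
  have "?E \<inter> X = E"
  proof (intro equalityI subsetI)
    fix y assume y: "y \<in> ?E \<inter> X"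
    then obtain k where k: "y - scale k v \<in> E" using Cons.prems by (auto simp: span_insert span_eq_iff[THEN iffD2])
    have "y - (y - scale k v) \<in> X"
      by (rule subspace_diff) (use k y Cons.prems in auto)
    hence "scale k v \<in> X" by simp
    hence "scale (inverse k) (scale k v) \<in> X" using Cons.prems subspace_scale by blast
    hence "k = 0" using Cons.prems by (cases "k = 0") auto
    thus "y \<in> E" using k by simp
  qed (use Cons.prems in \<open>auto intro: span_base\<close>)
  moreover have "span (E \<union> set (v # vs)) \<inter> X \<subseteq> ?E"
    using IH(2) sp by (auto intro: span_base)
  moreover have "E \<subseteq> span (E \<union> set (v # vs))" by (auto intro: span_base)
  ultimately show ?case using IH(1) sp dim_span_insert[OF Cons.prems(1) vE] Cons.prems(3) by auto
qed

lemma indep_over_antimono: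
  assumes "E \<subseteq> X" "indep_over X vs" shows "indep_over E vs"
  using assms
proof (induction vs arbitrary: E X)
  case (Cons v vs)
  have "span (insert v E) \<subseteq> span (insert v X)" using Cons.prems by (intro span_mono) auto
  thus ?case using Cons by auto
qed simp

lemma indep_over_Int:
  assumes "subspace F" "subspace X" "set vs \<subseteq> F" "indep_over (F \<inter> X) vs"
  shows "indep_over X vs"
  using assms
proof (induction vs arbitrary: X)
  case (Cons v vs)
  thus ?case using span_insert_Int[of F X v] by auto
qed simp

text \<open>Both the sequences extending \<^term>\<open>X\<close> inside \<^term>\<open>W\<close> and those extending \<^term>\<open>E\<close> inside a
  fixed subspace are counted; the former are partitioned by the subspace they span with \<^term>\<open>E\<close>.\<close>

lemma card_subspaces_Int_eq:
  assumes "subspace E" "subspace X" "subspace W" "E \<subseteq> X" "X \<subseteq> W"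
  shows "real (card {F. subspace F \<and> F \<subseteq> W \<and> dim F = dim E + m \<and> F \<inter> X = E})
    = real q ^ (m * (dim X - dim E)) * gb q (dim W - dim X) m"
proof -
  let ?N = "{F. subspace F \<and> F \<subseteq> W \<and> dim F = dim E + m \<and> F \<inter> X = E}"
  have eq: "ext_lists X W m = (\<Union>F\<in>?N. ext_lists E F m)"
  proof (intro equalityI subsetI)
    fix vs assume vs: "vs \<in> ext_lists X W m"
    let ?F = "span (E \<union> set vs)"
    have "?F \<subseteq> W" using vs assms by (intro span_minimal) (auto simp: ext_lists_def)
    hence "?F \<in> ?N" using vs assms ext_lists_span[of E X vs] by (auto simp: ext_lists_def)
    moreover have "vs \<in> ext_lists E ?F m"
      using vs indep_over_antimono[OF assms(4)] by (auto simp: ext_lists_def intro: span_base)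
    ultimately show "vs \<in> (\<Union>F\<in>?N. ext_lists E F m)" by blast
  next
    fix vs assume "vs \<in> (\<Union>F\<in>?N. ext_lists E F m)"
    then obtain F where "F \<in> ?N" "vs \<in> ext_lists E F m" by blast
    thus "vs \<in> ext_lists X W m" using indep_over_Int[of F X vs] assms by (auto simp: ext_lists_def)
  qed
  \<comment> \<open>A list recovers its subspace, by comparison of dimensions; hence the union over
    \<open>F\<close> is disjoint.\<close>
  have span_eq_F: "span (E \<union> set vs) = F" if "F \<in> ?N" "vs \<in> ext_lists E F m" for F vs
  proof (rule subspace_dim_equal)
    show "span (E \<union> set vs) \<subseteq> F" using that by (intro span_minimal) (auto simp: ext_lists_def)
    show "dim F \<le> dim (span (E \<union> set vs))"
      using that ext_lists_span[of E E vs] assms by (auto simp: ext_lists_def)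
    show "subspace F" using that by blast
  qed auto
  have 1: "card (ext_lists X W m) = (\<Sum>F\<in>?N. card (ext_lists E F m))"
    unfolding eq
  proof (rule card_UN_disjoint)
    show "\<forall>F\<in>?N. \<forall>F'\<in>?N. F \<noteq> F' \<longrightarrow> ext_lists E F m \<inter> ext_lists E F' m = {}"
    proof (intro ballI impI equals0I)
      fix F F' vs assume "F \<in> ?N" "F' \<in> ?N" "F \<noteq> F'" "vs \<in> ext_lists E F m \<inter> ext_lists E F' m"
      thus False using span_eq_F[of F vs] span_eq_F[of F' vs] by (metis IntD1 IntD2)
    qed
    show "finite ?N" by (rule finite_families)
  qed simp
  have 2: "real (\<Sum>F\<in>?N. card (ext_lists E F m)) = (\<Sum>F\<in>?N. \<Prod>i<m. real q ^ (dim E + m) - real q ^ (dim E + i))"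
    unfolding of_nat_sum
  proof (intro sum.cong refl)
    fix F assume "F \<in> ?N"
    thus "real (card (ext_lists E F m)) = (\<Prod>i<m. real q ^ (dim E + m) - real q ^ (dim E + i))"
      using card_ext_lists[of E F m] assms by auto
  qed
  have "(\<Prod>i<m. real q ^ dim W - real q ^ (dim X + i))
      = real (card ?N) * (\<Prod>i<m. real q ^ (dim E + m) - real q ^ (dim E + i))"
    using card_ext_lists[OF assms(2,3,5), of m] unfolding 1 2 by (simp only: sum_constant)
  hence "real (card ?N) * (\<Prod>i<m. real q ^ (dim E + m) - real q ^ (dim E + i))
      = real q ^ (m * (dim X - dim E)) * gb q (dim W - dim X) m
        * (\<Prod>i<m. real q ^ (dim E + m) - real q ^ (dim E + i))"
    using prod_power_diff_eq_gb[OF real_q_gt_1 dim_subset[OF assms(4)] dim_subset[OF assms(5)], of m]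
    by (metis (no_types))
  moreover have "(\<Prod>i<m. real q ^ (dim E + m) - real q ^ (dim E + i)) \<noteq> 0"
    using real_q_gt_1 by (intro less_imp_neq[symmetric] prod_pos) (auto intro!: power_strict_increasing)
  ultimately show ?thesis by (rule mult_right_cancel[THEN iffD1, rotated])
qed

lemma mem_subspaces_of_dim [simp]:
  "U \<in> subspaces_of_dim scale X k \<longleftrightarrow> subspace U \<and> U \<subseteq> X \<and> dim U = k"
  by (simp add: subspaces_of_dim_def)

lemma card_subspaces_above:
  assumes "subspace E" "subspace W" "E \<subseteq> W" "dim E \<le> d"
  shows "real (card {F \<in> subspaces_of_dim scale W d. E \<subseteq> F}) = gb q (dim W - dim E) (d - dim E)"
proof -
  have "{F \<in> subspaces_of_dim scale W d. E \<subseteq> F}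
      = {F. subspace F \<and> F \<subseteq> W \<and> dim F = dim E + (d - dim E) \<and> F \<inter> E = E}"
    using assms(4) by auto
  thus ?thesis using card_subspaces_Int_eq[of E E W "d - dim E"] assms by simp
qed

lemma card_subspaces_of_dim:
  assumes "subspace W" shows "real (card (subspaces_of_dim scale W d)) = gb q (dim W) d"
proof -
  have "{F \<in> subspaces_of_dim scale W d. {0} \<subseteq> F} = subspaces_of_dim scale W d"
    using subspace_0 by auto
  thus ?thesis using card_subspaces_above[of "{0}" W d] assms subspace_0 by simp
qed

lemma card_H2:
  assumes "subspace E" "subspace X" "E \<subseteq> X" "dim E \<le> k"
  shows "real (card (H2 scale X E k))
    = real q ^ ((k - dim E) * (dim X - dim E)) * gb q (dim (UNIV :: 'b set) - dim X) (k - dim E)"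
proof -
  have "H2 scale X E k = {F. subspace F \<and> F \<subseteq> UNIV \<and> dim F = dim E + (k - dim E) \<and> F \<inter> X = E}"
    using assms(4) by (auto simp: H2_def)
  thus ?thesis using card_subspaces_Int_eq[of E X UNIV "k - dim E"] assms by simp
qed

section \<open>Intermediate subspaces and extensions by one dimension\<close>

lemma exists_subspace_between:
  assumes "subspace E" "subspace W" "E \<subseteq> W" "dim E \<le> d" "d \<le> dim W"
  obtains F where "subspace F" "E \<subseteq> F" "F \<subseteq> W" "dim F = d"
proof -
  have "real (card {F \<in> subspaces_of_dim scale W d. E \<subseteq> F}) > 0"
    using assms by (simp only: card_subspaces_above) (auto intro!: gb_pos real_q_gt_1)
  hence "{F \<in> subspaces_of_dim scale W d. E \<subseteq> F} \<noteq> {}" by (metis card.empty less_irrefl of_nat_0)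
  thus ?thesis using that by auto
qed

lemma exists_subspace_of_dim:
  assumes "subspace W" "d \<le> dim W"
  obtains F where "subspace F" "F \<subseteq> W" "dim F = d"
  using exists_subspace_between[OF subspace_single_0 assms(1), of d] assms subspace_0 by auto

lemma dim_span_Un:
  assumes "subspace S" "subspace T"
  shows "dim (span (S \<union> T)) + dim (S \<inter> T) = dim S + dim T"
  using dim_sums_Int[OF assms] assms by (simp add: span_Un span_eq_iff[THEN iffD2])

lemma exists_mem_diff_of_dim_less:
  assumes "subspace S" "dim S < dim T" obtains x where "x \<in> T" "x \<notin> S"
  using assms dim_subset[of T S] by fastforce

text \<open>Cutting \<^term>\<open>G\<close> down to codimension \<^term>\<open>t - 1 - dim (S \<inter> G)\<close> keeps the number of
  extensions by one dimension down to that of the case where \<^term>\<open>dim (S \<inter> G) = t - 1\<close>.\<close>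

lemma one_step_extensions:
  assumes S: "subspace S" and G: "subspace G" and lt: "dim (S \<inter> G) < t" and le: "t \<le> dim G"
  obtains \<S> where "real (card \<S>) \<le> qint q (dim G - t + 1)"
    "\<And>S'. S' \<in> \<S> \<Longrightarrow> subspace S' \<and> dim S' = Suc (dim S) \<and> S \<subseteq> S' \<and> S' \<subseteq> span (S \<union> G)
        \<and> dim (S' \<inter> G) = Suc (dim (S \<inter> G))"
    "\<And>F. subspace F \<Longrightarrow> S \<subseteq> F \<Longrightarrow> t \<le> dim (F \<inter> G) \<Longrightarrow> \<exists>S'\<in>\<S>. S' \<subseteq> F"
proof -
  have SG: "subspace (S \<inter> G)" using S G by (rule subspace_inter)
  have h: "dim (S \<inter> G) \<le> dim (S \<inter> G) + (dim G - t + 1)" "dim (S \<inter> G) + (dim G - t + 1) \<le> dim G"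
    using lt le by auto
  obtain G1 where G1: "subspace G1" "S \<inter> G \<subseteq> G1" "G1 \<subseteq> G" "dim G1 = dim (S \<inter> G) + (dim G - t + 1)"
    by (rule exists_subspace_between[OF SG G Int_lower2 h])
  have SG1: "S \<inter> G1 = S \<inter> G" using G1 by auto
  define \<S> where "\<S> = {S' \<in> subspaces_of_dim scale (span (S \<union> G1)) (Suc (dim S)). S \<subseteq> S'}"
  have d1: "dim (span (S \<union> G1)) = dim S + (dim G - t + 1)"
    using dim_span_Un[OF S G1(1)] SG1 G1(4) by simp
  have SsubG1: "S \<subseteq> span (S \<union> G1)" by (auto intro: span_base)
  have "real (card \<S>) = gb q (dim G - t + 1) 1"
    unfolding \<S>_def using card_subspaces_above[OF S _ SsubG1, of "Suc (dim S)"] d1 by simp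
  hence "real (card \<S>) \<le> qint q (dim G - t + 1)" by (simp add: gb_1)
  moreover have "subspace S' \<and> dim S' = Suc (dim S) \<and> S \<subseteq> S' \<and> S' \<subseteq> span (S \<union> G)
        \<and> dim (S' \<inter> G) = Suc (dim (S \<inter> G))" if "S' \<in> \<S>" for S'
  proof -
    have S': "subspace S'" "S' \<subseteq> span (S \<union> G1)" "dim S' = Suc (dim S)" "S \<subseteq> S'"
      using that by (auto simp: \<S>_def)
    have sub: "S' \<subseteq> span (S \<union> G)" using S'(2) span_mono[of "S \<union> G1" "S \<union> G"] G1(3) by blast
    have "span (S' \<union> G) = span (S \<union> G)"
    proof (intro equalityI span_minimal subspace_span)
      show "S' \<union> G \<subseteq> span (S \<union> G)" using sub by (auto intro: span_base)
      show "S \<union> G \<subseteq> span (S' \<union> G)" using S'(4) by (auto intro: span_base)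
    qed
    hence "dim (S' \<inter> G) = Suc (dim (S \<inter> G))"
      using dim_span_Un[OF S G] dim_span_Un[OF S'(1) G] S'(3) by simp
    thus ?thesis using S' sub by blast
  qed
  moreover have "\<exists>S'\<in>\<S>. S' \<subseteq> F" if F: "subspace F" "S \<subseteq> F" "t \<le> dim (F \<inter> G)" for F
  proof -
    \<comment> \<open>\<open>F \<inter> G\<close> and \<open>G1\<close> both lie in
      \<open>G\<close>, so they meet in dimension at least \<open>dim (S \<inter> G) + 1\<close>. A
      vector of this intersection outside \<open>S\<close> gives the required extension inside
      \<open>F\<close>.\<close>
    have "dim (span ((F \<inter> G) \<union> G1)) \<le> dim G"
      using G1(3) G by (intro dim_subset span_minimal) auto
    moreover have "F \<inter> G \<inter> G1 = F \<inter> G1" using G1(3) by auto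
    ultimately have "dim (S \<inter> G) < dim (F \<inter> G1)"
      using dim_span_Un[OF subspace_inter[OF F(1) G] G1(1)] F(3) G1(4) lt le by simp
    then obtain x where x: "x \<in> F \<inter> G1" "x \<notin> S \<inter> G"
      using exists_mem_diff_of_dim_less[OF SG] by metis
    have xS: "x \<notin> S" using x G1(3) by auto
    have "span (insert x S) \<subseteq> span (S \<union> G1)" using x by (intro span_mono) auto
    moreover have "S \<subseteq> span (insert x S)" by (auto intro: span_base)
    ultimately have "span (insert x S) \<in> \<S>" using dim_span_insert[OF S xS] by (simp add: \<S>_def)
    moreover have "span (insert x S) \<subseteq> F" using x F by (intro span_minimal) auto
    ultimately show ?thesis by blast
  qed
  ultimately show ?thesis by (rule that)
qed

lemma card_le_sum_cover:
  assumes "finite I" "A \<subseteq> (\<Union>i\<in>I. f i)" "\<And>i. i \<in> I \<Longrightarrow> real (card (f i :: 'b set set)) \<le> M"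
  shows "real (card A) \<le> real (card I) * M"
proof -
  have "card A \<le> (\<Sum>i\<in>I. card (f i))"
    using card_mono[OF finite_families assms(2)] card_UN_le[OF assms(1), of f] by linarith
  moreover have "(\<Sum>i\<in>I. real (card (f i))) \<le> (\<Sum>i\<in>I. M)" by (intro sum_mono assms(3))
  ultimately show ?thesis by (simp flip: of_nat_sum)
qed

text \<open>Only members meeting \<open>G\<close> in dimension at least \<open>t\<close> are
  counted. Keeping the exceptional ones out lets several steps against the same \<open>G\<close> pay
  for them only once.\<close>

lemma card_step:
  assumes "subspace S" "subspace G" "dim (S \<inter> G) < t" "t \<le> dim G" "0 \<le> M"
    and "\<And>A. A \<in> \<F> \<Longrightarrow> subspace A"
    and "\<And>S'. subspace S' \<Longrightarrow> dim S' = Suc (dim S) \<Longrightarrow> S \<subseteq> S' \<Longrightarrow> S' \<subseteq> span (S \<union> G) \<Longrightarrow>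
      dim (S' \<inter> G) = Suc (dim (S \<inter> G)) \<Longrightarrow> real (card {A \<in> \<F>. S' \<subseteq> A \<and> t \<le> dim (A \<inter> G)}) \<le> M"
  shows "real (card {A \<in> \<F>. S \<subseteq> A \<and> t \<le> dim (A \<inter> G)}) \<le> qint q (dim G - t + 1) * M"
proof -
  obtain \<S> where \<S>: "real (card \<S>) \<le> qint q (dim G - t + 1)"
    "\<And>S'. S' \<in> \<S> \<Longrightarrow> subspace S' \<and> dim S' = Suc (dim S) \<and> S \<subseteq> S' \<and> S' \<subseteq> span (S \<union> G)
        \<and> dim (S' \<inter> G) = Suc (dim (S \<inter> G))"
    "\<And>F. subspace F \<Longrightarrow> S \<subseteq> F \<Longrightarrow> t \<le> dim (F \<inter> G) \<Longrightarrow> \<exists>S'\<in>\<S>. S' \<subseteq> F"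
    using one_step_extensions[OF assms(1-4)] by blast
  have "real (card {A \<in> \<F>. S \<subseteq> A \<and> t \<le> dim (A \<inter> G)}) \<le> real (card \<S>) * M"
  proof (rule card_le_sum_cover)
    show "{A \<in> \<F>. S \<subseteq> A \<and> t \<le> dim (A \<inter> G)} \<subseteq> (\<Union>S'\<in>\<S>. {A \<in> \<F>. S' \<subseteq> A \<and> t \<le> dim (A \<inter> G)})"
      using \<S>(3) assms(6) by auto
    show "real (card {A \<in> \<F>. S' \<subseteq> A \<and> t \<le> dim (A \<inter> G)}) \<le> M" if "S' \<in> \<S>" for S'
      using \<S>(2)[OF that] assms(7) by blast
  qed simp
  also have "\<dots> \<le> qint q (dim G - t + 1) * M" using \<S>(1) assms(5) by (rule mult_right_mono)
  finally show ?thesis .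
qed

section \<open>Members of a family through a fixed subspace\<close>

definition above :: "'b set set \<Rightarrow> 'b set \<Rightarrow> 'b set set" where
  "above \<F> S = {A \<in> \<F>. S \<subseteq> A}"

lemma card_le_D_fam:
  assumes "real (card {A \<in> \<G>. t \<le> dim (A \<inter> G)}) \<le> x" "\<G> \<subseteq> \<F>" "card (D_fam scale \<F> G t) \<le> s"
  shows "real (card \<G>) \<le> real s + x"
proof -
  have "\<G> \<subseteq> D_fam scale \<F> G t \<union> {A \<in> \<G>. t \<le> dim (A \<inter> G)}" using assms(2) by (auto simp: D_fam_def)
  hence "card \<G> \<le> card (D_fam scale \<F> G t \<union> {A \<in> \<G>. t \<le> dim (A \<inter> G)})"
    by (rule card_mono[OF finite_families])
  also have "\<dots> \<le> card (D_fam scale \<F> G t) + card {A \<in> \<G>. t \<le> dim (A \<inter> G)}" by (rule card_Un_le)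
  finally show ?thesis using assms by linarith
qed

lemma card_above_step:
  assumes "subspace S" "subspace G" "dim (S \<inter> G) < t" "t \<le> dim G" "0 \<le> M"
    and "\<And>A. A \<in> \<F> \<Longrightarrow> subspace A" and "card (D_fam scale \<F> G t) \<le> s"
    and "\<And>S'. subspace S' \<Longrightarrow> dim S' = Suc (dim S) \<Longrightarrow> real (card (above \<F> S')) \<le> M"
  shows "real (card (above \<F> S)) \<le> real s + qint q (dim G - t + 1) * M"
proof (rule card_le_D_fam)
  have "{A \<in> above \<F> S. t \<le> dim (A \<inter> G)} = {A \<in> \<F>. S \<subseteq> A \<and> t \<le> dim (A \<inter> G)}"
    by (auto simp: above_def)
  moreover have "real (card {A \<in> \<F>. S \<subseteq> A \<and> t \<le> dim (A \<inter> G)}) \<le> qint q (dim G - t + 1) * M"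
  proof (rule card_step[OF assms(1-6)])
    fix S' assume "subspace S'" "dim S' = Suc (dim S)"
    moreover have "card {A \<in> \<F>. S' \<subseteq> A \<and> t \<le> dim (A \<inter> G)} \<le> card (above \<F> S')"
      by (rule card_mono[OF finite_families]) (auto simp: above_def)
    ultimately show "real (card {A \<in> \<F>. S' \<subseteq> A \<and> t \<le> dim (A \<inter> G)}) \<le> M"
      using assms(8)[of S'] by linarith
  qed
  ultimately show "real (card {A \<in> above \<F> S. t \<le> dim (A \<inter> G)}) \<le> qint q (dim G - t + 1) * M"
    by simp
  show "above \<F> S \<subseteq> \<F>" by (auto simp: above_def)
qed (rule assms(7))

lemma card_le_cover:
  assumes "subspace T" "\<And>A. A \<in> \<F> \<Longrightarrow> subspace A \<and> t \<le> dim (A \<inter> T)"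
    and "\<And>S. subspace S \<Longrightarrow> dim S = t \<Longrightarrow> S \<subseteq> T \<Longrightarrow> real (card (above \<F> S)) \<le> M"
  shows "real (card \<F>) \<le> gb q (dim T) t * M"
proof -
  have "real (card \<F>) \<le> real (card (subspaces_of_dim scale T t)) * M"
  proof (rule card_le_sum_cover)
    show "\<F> \<subseteq> (\<Union>S\<in>subspaces_of_dim scale T t. above \<F> S)"
    proof
      fix A assume A: "A \<in> \<F>"
      have "subspace (A \<inter> T)" "t \<le> dim (A \<inter> T)" using assms(1,2) A by (auto intro: subspace_inter)
      then obtain S where "subspace S" "S \<subseteq> A \<inter> T" "dim S = t"
        by (rule exists_subspace_of_dim)
      thus "A \<in> (\<Union>S\<in>subspaces_of_dim scale T t. above \<F> S)" using A by (auto simp: above_def)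
    qed
  qed (use assms(3) in auto)
  thus ?thesis using card_subspaces_of_dim[OF assms(1)] by simp
qed

lemma card_above_le:
  assumes "\<F> \<subseteq> subspaces_of_dim scale UNIV k" "subspace S" "dim S \<le> k"
  shows "real (card (above \<F> S)) \<le> gb q (dim (UNIV :: 'b set) - dim S) (k - dim S)"
proof -
  have "card (above \<F> S) \<le> card {F \<in> subspaces_of_dim scale UNIV k. S \<subseteq> F}"
    by (rule card_mono[OF finite_families]) (use assms(1) in \<open>auto simp: above_def\<close>)
  hence "real (card (above \<F> S)) \<le> real (card {F \<in> subspaces_of_dim scale UNIV k. S \<subseteq> F})"
    by (rule of_nat_mono)
  thus ?thesis by (simp only: card_subspaces_above[OF assms(2) subspace_UNIV subset_UNIV assms(3)])
qed

text \<open>Induction downwards from dimension \<open>t + j\<close>, where the trivial count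
  applies. Below that dimension some \<open>G\<close> always meets \<open>S\<close> in dimension
  less than \<open>t\<close>, possibly a new one each time; every step therefore multiplies by
  \<open>c\<close> and adds \<open>s\<close>, which produces the geometric sum.\<close>

lemma card_above_level:
  assumes "\<F> \<subseteq> subspaces_of_dim scale UNIV k" "\<G> \<subseteq> subspaces_of_dim scale UNIV k"
    and "\<And>G. G \<in> \<G> \<Longrightarrow> card (D_fam scale \<F> G t) \<le> s"
    and "\<And>T. subspace T \<Longrightarrow> dim T < t + j \<Longrightarrow> \<exists>G\<in>\<G>. dim (T \<inter> G) < t"
    and "t + j \<le> k" "l \<le> j" "subspace S" "dim S = t + (j - l)"
  shows "real (card (above \<F> S)) \<le>
    qint q (k - t + 1) ^ l * gb q (dim (UNIV :: 'b set) - (t + j)) (k - (t + j))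
      + real s * (\<Sum>i<l. qint q (k - t + 1) ^ i)"
  using assms(6-8)
proof (induction l arbitrary: S)
  case 0
  thus ?case using card_above_le[OF assms(1), of S] assms(5) by simp
next
  case (Suc l)
  let ?c = "qint q (k - t + 1)" and ?B = "gb q (dim (UNIV :: 'b set) - (t + j)) (k - (t + j))"
  let ?M = "?c ^ l * ?B + real s * (\<Sum>i<l. ?c ^ i)"
  obtain G where G: "G \<in> \<G>" "dim (S \<inter> G) < t" using assms(4)[of S] Suc.prems by auto
  have "0 \<le> ?M" using gb_nonneg[OF real_q_gt_1] qint_nonneg[OF real_q_gt_1]
    by (intro add_nonneg_nonneg mult_nonneg_nonneg sum_nonneg) auto
  moreover have "real (card (above \<F> S')) \<le> ?M" if "subspace S'" "dim S' = Suc (dim S)" for S'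
    using that Suc.prems by (intro Suc.IH) auto
  ultimately have "real (card (above \<F> S)) \<le> real s + qint q (dim G - t + 1) * ?M"
    using G assms Suc.prems by (intro card_above_step[of S G t]) auto
  moreover have "dim G = k" using G assms(2) by auto
  moreover have "real s + ?c * ?M = ?c ^ Suc l * ?B + real s * (\<Sum>i<Suc l. ?c ^ i)"
    by (subst sum.lessThan_Suc_shift) (simp add: algebra_simps sum_distrib_left)
  ultimately show ?case by simp
qed

end

section \<open>The possible shapes of an almost cross-intersecting pair\<close>

locale almost_cross_setting = finite_field_vector_space scale Basis q
  for scale :: "'a::{field,finite} \<Rightarrow> 'b::ab_group_add \<Rightarrow> 'b" and Basis q +
  fixes n k t s :: nat
  assumes dim_V: "dim (UNIV :: 'b set) = n"
    and t_pos: "0 < t" and s_pos: "0 < s" and k_ge: "t + 2 \<le> k"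
    and n_ge: "13 * real s * real q ^ (3 * k + 3 * t + 1) \<le> real q ^ n"
begin

declare dim_UNIV [simp del]

abbreviation c :: real where "c \<equiv> qint q (k - t + 1)"

definition B :: "nat \<Rightarrow> real" where "B i = gb q (n - (t + i)) (k - (t + i))"

text \<open>The bound of \<open>card_above_level\<close> after \<open>j\<close> steps: it applies to
  the members through a t-space when no space of dimension below \<open>t + j\<close> covers the
  other family.\<close>

definition \<phi> :: "nat \<Rightarrow> real" where "\<phi> j = c ^ j * B j + real s * (\<Sum>i<j. c ^ i)"

abbreviation Gr :: "'b set set" where "Gr \<equiv> subspaces_of_dim scale UNIV k"

lemma B_nonneg: "0 \<le> B i"
  unfolding B_def by (rule gb_nonneg[OF real_q_gt_1])

lemma c_nonneg: "0 \<le> c"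
  by (rule qint_nonneg[OF real_q_gt_1])

lemma \<phi>_nonneg: "0 \<le> \<phi> j"
  unfolding \<phi>_def using B_nonneg c_nonneg
  by (intro add_nonneg_nonneg mult_nonneg_nonneg sum_nonneg) auto

lemma card_above_le_B:
  assumes "\<F> \<subseteq> Gr" "subspace S" "dim S = t + i" "t + i \<le> k"
  shows "real (card (above \<F> S)) \<le> B i"
  using card_above_le[OF assms(1,2)] assms(3,4) dim_V by (simp add: B_def)

definition almost_cross :: "'b set set \<Rightarrow> 'b set set \<Rightarrow> bool" where
  "almost_cross \<F> \<G> \<longleftrightarrow> \<F> \<subseteq> Gr \<and> \<G> \<subseteq> Gr \<and> (\<forall>G\<in>\<G>. card (D_fam scale \<F> G t) \<le> s)
     \<and> (\<forall>F\<in>\<F>. card (D_fam scale \<G> F t) \<le> s)"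

lemma almost_cross_sym: "almost_cross \<F> \<G> \<Longrightarrow> almost_cross \<G> \<F>"
  by (auto simp: almost_cross_def)

lemma dim_Int_less:
  assumes "subspace S" "dim S = t" "subspace A" "\<not> S \<subseteq> A" shows "dim (S \<inter> A) < t"
proof (rule ccontr)
  assume "\<not> dim (S \<inter> A) < t"
  hence "S \<inter> A = S" using assms by (intro subspace_dim_equal) (auto intro: subspace_inter)
  thus False using assms(4) by auto
qed

lemma card_above_t:
  assumes "almost_cross \<F> \<G>" "G \<in> \<G>" "subspace S" "dim S = t" "\<not> S \<subseteq> G"
  shows "real (card (above \<F> S)) \<le> real s + c * B 1"
proof -
  have G: "subspace G" "dim G = k" "card (D_fam scale \<F> G t) \<le> s" "\<F> \<subseteq> Gr"
    using assms(1,2) by (auto simp: almost_cross_def)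
  have "real (card (above \<F> S)) \<le> real s + qint q (dim G - t + 1) * B 1"
  proof (rule card_above_step)
    show "real (card (above \<F> S')) \<le> B 1" if "subspace S'" "dim S' = Suc (dim S)" for S'
      using that assms(4) G k_ge by (intro card_above_le_B) auto
  qed (use G assms k_ge B_nonneg dim_Int_less[of S G] in auto)
  thus ?thesis using G by simp
qed

section \<open>Cover levels and the bounds they give\<close>

definition is_cover :: "'b set set \<Rightarrow> nat \<Rightarrow> bool" where
  "is_cover \<G> j \<longleftrightarrow> (\<exists>T. subspace T \<and> dim T = t + j \<and> (\<forall>G\<in>\<G>. t \<le> dim (G \<inter> T)))"

text \<open>The cap \<open>j = k - t\<close> keeps the level within dimension \<open>k\<close> even
  if no cover that small exists. In that case a member of the opposite family serves as a cover up
  to \<open>s\<close> exceptions.\<close>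

lemma obtain_level:
  assumes "\<G> \<noteq> {}" "\<not> is_cover \<G> 0"
  obtains j where "1 \<le> j" "t + j \<le> k" "is_cover \<G> j \<or> j = k - t"
    "\<And>T. subspace T \<Longrightarrow> dim T < t + j \<Longrightarrow> \<exists>G\<in>\<G>. dim (T \<inter> G) < t"
proof -
  define j where "j = (LEAST j. is_cover \<G> j \<or> j = k - t)"
  have 1: "is_cover \<G> j \<or> j = k - t" unfolding j_def by (rule LeastI[of _ "k - t"]) simp
  have 2: "j \<le> k - t" unfolding j_def by (rule Least_le) simp
  have 3: "\<not> is_cover \<G> i" if "i < j" for i using not_less_Least that unfolding j_def by blast
  have "j \<noteq> 0"
  proof
    assume "j = 0"
    thus False using 1 assms(2) k_ge by auto
  qed
  moreover have "\<exists>G\<in>\<G>. dim (T \<inter> G) < t" if T: "subspace T" "dim T < t + j" for T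
  proof (cases "t \<le> dim T")
    case True
    hence "\<not> is_cover \<G> (dim T - t)" using T(2) by (intro 3) auto
    hence "\<exists>G\<in>\<G>. \<not> t \<le> dim (G \<inter> T)" using T(1) True by (auto simp: is_cover_def)
    thus ?thesis by (auto simp: not_le Int_commute)
  next
    case False
    obtain G where "G \<in> \<G>" using assms(1) by blast
    moreover have "dim (T \<inter> G) \<le> dim T" by (intro dim_subset) auto
    ultimately show ?thesis using False by (intro bexI[of _ G]) auto
  qed
  ultimately show ?thesis using that[of j] 1 2 k_ge by auto
qed

lemma card_above_\<phi>:
  assumes "almost_cross \<F> \<G>" "t + j \<le> k" "subspace S" "dim S = t"
    and "\<And>T. subspace T \<Longrightarrow> dim T < t + j \<Longrightarrow> \<exists>G\<in>\<G>. dim (T \<inter> G) < t"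
  shows "real (card (above \<F> S)) \<le> \<phi> j"
proof -
  have "\<F> \<subseteq> Gr" "\<G> \<subseteq> Gr" "\<And>G. G \<in> \<G> \<Longrightarrow> card (D_fam scale \<F> G t) \<le> s"
    using assms(1) by (auto simp: almost_cross_def)
  thus ?thesis using card_above_level[of \<F> k \<G> t s j j S] assms dim_V by (simp add: \<phi>_def B_def)
qed

lemma gb_ge_1: "1 \<le> gb q (b + j) b"
proof (induction b)
  case (Suc b)
  have "1 \<le> real q ^ j" using real_q_gt_1 by (intro one_le_power) auto
  hence "1 * 1 \<le> real q ^ j * gb q (b + j) b" using Suc by (intro mult_mono) auto
  also have "\<dots> \<le> gb q (Suc (b + j)) (Suc b)" using gb_ratio[OF real_q_gt_1, of b "b + j"] by simp
  finally show ?case by simp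
qed simp

text \<open>The factor 2 pays for the at most \<open>s \<le> M\<close> members that are missed when
  the level is the cap and a member \<open>F\<close> of the other family replaces the cover.\<close>

lemma card_le_level:
  assumes "almost_cross \<F> \<G>" "\<F> \<noteq> {}" "is_cover \<G> j \<or> j = k - t" "t + j \<le> k" "real s \<le> M"
    and M: "\<And>S. subspace S \<Longrightarrow> dim S = t \<Longrightarrow> real (card (above \<G> S)) \<le> M"
  shows "real (card \<G>) \<le> 2 * (gb q (t + j) t * M)"
proof -
  have M0: "0 \<le> M" using assms(5) by linarith
  have ge: "M \<le> gb q (t + j) t * M"
    using mult_right_mono[OF gb_ge_1[of t j] M0] by simp
  show ?thesis using assms(3)
  proof
    assume "is_cover \<G> j"
    then obtain T where T: "subspace T" "dim T = t + j" "\<forall>G\<in>\<G>. t \<le> dim (G \<inter> T)"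
      by (auto simp: is_cover_def)
    hence "real (card \<G>) \<le> gb q (dim T) t * M"
      using assms(1) by (intro card_le_cover M) (auto simp: almost_cross_def)
    thus ?thesis using T(2) ge M0 by auto
  next
    assume j: "j = k - t"
    obtain F where F: "F \<in> \<F>" using assms(2) by blast
    have F': "subspace F" "dim F = k" "card (D_fam scale \<G> F t) \<le> s" "\<G> \<subseteq> Gr"
      using assms(1) F by (auto simp: almost_cross_def)
    have "real (card {A \<in> \<G>. t \<le> dim (A \<inter> F)}) \<le> gb q (dim F) t * M"
    proof (rule card_le_cover)
      fix S assume "subspace S" "dim S = t"
      hence "real (card (above \<G> S)) \<le> M" by (rule M)
      moreover have "card (above {A \<in> \<G>. t \<le> dim (A \<inter> F)} S) \<le> card (above \<G> S)"
        by (rule card_mono[OF finite_families]) (auto simp: above_def)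
      ultimately show "real (card (above {A \<in> \<G>. t \<le> dim (A \<inter> F)} S)) \<le> M" by linarith
    qed (use F' in auto)
    hence "real (card \<G>) \<le> real s + gb q k t * M"
      using card_le_D_fam[of \<G> t F _ \<G> s] F' by auto
    moreover have "t + j = k" using j k_ge by simp
    ultimately show ?thesis using ge assms(5) by auto
  qed
qed

text \<open>An extension of \<open>E\<close> raises the dimension of the intersection with
  \<open>G\<close> by exactly one, so it is still below \<open>t\<close> and a second step against
  the same \<open>G\<close> is possible. The exceptions cost \<open>s\<close> only once.\<close>

lemma card_le_two_steps:
  assumes "almost_cross \<F> \<G>" "G \<in> \<G>" "subspace E" "dim E = t" "\<And>A. A \<in> \<F> \<Longrightarrow> E \<subseteq> A" "dim (E \<inter> G) + 2 \<le> t"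
  shows "real (card \<F>) \<le> real s + c * (c * B 2)"
proof -
  have G: "subspace G" "dim G = k" "card (D_fam scale \<F> G t) \<le> s" "\<F> \<subseteq> Gr"
    using assms(1,2) by (auto simp: almost_cross_def)
  have sub: "subspace A" if "A \<in> \<F>" for A using that G(4) by auto
  have "real (card {A \<in> \<F>. E \<subseteq> A \<and> t \<le> dim (A \<inter> G)}) \<le> qint q (dim G - t + 1) * (c * B 2)"
  proof (rule card_step)
    fix S' assume S': "subspace S'" "dim S' = Suc (dim E)" "dim (S' \<inter> G) = Suc (dim (E \<inter> G))"
    have "real (card {A \<in> \<F>. S' \<subseteq> A \<and> t \<le> dim (A \<inter> G)}) \<le> qint q (dim G - t + 1) * B 2"
    proof (rule card_step)
      fix S'' assume S'': "subspace S''" "dim S'' = Suc (dim S')"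
      have "card {A \<in> \<F>. S'' \<subseteq> A \<and> t \<le> dim (A \<inter> G)} \<le> card (above \<F> S'')"
        by (rule card_mono[OF finite_families]) (auto simp: above_def)
      moreover have "real (card (above \<F> S'')) \<le> B 2"
        using S' S'' assms(4) G k_ge by (intro card_above_le_B) auto
      ultimately show "real (card {A \<in> \<F>. S'' \<subseteq> A \<and> t \<le> dim (A \<inter> G)}) \<le> B 2" by linarith
    qed (use S' assms G k_ge B_nonneg sub in auto)
    thus "real (card {A \<in> \<F>. S' \<subseteq> A \<and> t \<le> dim (A \<inter> G)}) \<le> c * B 2" using G by simp
  qed (use assms G k_ge B_nonneg c_nonneg sub in auto)
  moreover have "{A \<in> \<F>. E \<subseteq> A \<and> t \<le> dim (A \<inter> G)} = {A \<in> \<F>. t \<le> dim (A \<inter> G)}"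
    using assms(5) by auto
  ultimately have "real (card {A \<in> \<F>. t \<le> dim (A \<inter> G)}) \<le> c * (c * B 2)" using G by simp
  thus ?thesis by (rule card_le_D_fam[OF _ subset_refl G(3)])
qed

lemma dim_span_Un_hyperplane:
  assumes "subspace E" "dim E = t" "subspace G" "dim G = k" "dim (E \<inter> G) = t - 1"
  shows "dim (span (E \<union> G)) = k + 1"
  using dim_span_Un[OF assms(1,3)] assms t_pos by simp

text \<open>A member of \<open>\<F>\<close> in general position to neither \<open>G0\<close> nor
  \<open>G1\<close>, that is, meeting both in dimension at least \<open>t\<close>, contains a
  one-step extension \<open>S'\<close> of \<open>E\<close> inside the first span. If
  \<open>S'\<close> also lies in the second span, it lies in their intersection, of dimension at
  most \<open>k\<close>, which leaves only \<open>qint q (k - t)\<close> choices instead of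
  \<open>c\<close>. Otherwise \<open>S'\<close> meets \<open>G1\<close> in dimension less than
  \<open>t\<close>, and a further step brings the count down to \<open>B 2\<close>.\<close>

lemma card_le_two_hyperplanes:
  assumes "almost_cross \<F> \<G>" "G0 \<in> \<G>" "G1 \<in> \<G>" "subspace E" "dim E = t" "\<And>A. A \<in> \<F> \<Longrightarrow> E \<subseteq> A"
    and "dim (E \<inter> G0) = t - 1" "dim (E \<inter> G1) = t - 1" "span (E \<union> G0) \<noteq> span (E \<union> G1)"
  shows "real (card \<F>) \<le> 2 * real s + qint q (k - t) * B 1 + c * (c * B 2)"
proof -
  let ?X0 = "span (E \<union> G0)" and ?X1 = "span (E \<union> G1)"
  have G: "subspace G0" "dim G0 = k" "card (D_fam scale \<F> G0 t) \<le> s"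
    "subspace G1" "dim G1 = k" "card (D_fam scale \<F> G1 t) \<le> s" "\<F> \<subseteq> Gr"
    using assms(1-3) by (auto simp: almost_cross_def)
  have sub: "subspace A" if "A \<in> \<F>" for A using that G(7) by auto
  have dX: "dim ?X0 = k + 1" "dim ?X1 = k + 1"
    using dim_span_Un_hyperplane assms G by auto
  have EX: "E \<subseteq> ?X0" "E \<subseteq> ?X1" "E \<subseteq> ?X0 \<inter> ?X1" by (auto intro: span_base)
  have "?X0 \<inter> ?X1 \<noteq> ?X0"
  proof
    assume "?X0 \<inter> ?X1 = ?X0"
    hence "?X0 = ?X1" using dX by (intro subspace_dim_equal) auto
    thus False using assms(9) by contradiction
  qed
  hence "\<not> dim ?X0 \<le> dim (?X0 \<inter> ?X1)"
    using subspace_dim_equal[OF subspace_inter[OF subspace_span subspace_span] subspace_span Int_lower1]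
    by blast
  hence dX01: "dim (?X0 \<inter> ?X1) \<le> k" using dX(1) by linarith
  obtain \<S> where \<S>: "real (card \<S>) \<le> qint q (dim G0 - t + 1)"
    "\<And>S'. S' \<in> \<S> \<Longrightarrow> subspace S' \<and> dim S' = Suc (dim E) \<and> E \<subseteq> S' \<and> S' \<subseteq> ?X0
        \<and> dim (S' \<inter> G0) = Suc (dim (E \<inter> G0))"
    "\<And>F. subspace F \<Longrightarrow> E \<subseteq> F \<Longrightarrow> t \<le> dim (F \<inter> G0) \<Longrightarrow> \<exists>S'\<in>\<S>. S' \<subseteq> F"
    by (rule one_step_extensions[of E G0 t]) (use assms G k_ge t_pos in auto)
  let ?f = "\<lambda>S'. {A \<in> \<F>. S' \<subseteq> A \<and> t \<le> dim (A \<inter> G1)}"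
  let ?S1 = "{S' \<in> \<S>. S' \<subseteq> ?X1}" and ?S2 = "{S' \<in> \<S>. \<not> S' \<subseteq> ?X1}"
  have "real (card (\<Union>S'\<in>?S1. ?f S')) \<le> real (card ?S1) * B 1"
  proof (rule card_le_sum_cover)
    fix S' assume "S' \<in> ?S1"
    hence "real (card (above \<F> S')) \<le> B 1"
      using \<S>(2) G assms(5) k_ge by (intro card_above_le_B) auto
    moreover have "card (?f S') \<le> card (above \<F> S')"
      by (rule card_mono[OF finite_families]) (auto simp: above_def)
    ultimately show "real (card (?f S')) \<le> B 1" by linarith
  qed auto
  also have "\<dots> \<le> qint q (k - t) * B 1"
  proof (rule mult_right_mono[OF _ B_nonneg])
    let ?P = "{F \<in> subspaces_of_dim scale (?X0 \<inter> ?X1) (t + 1). E \<subseteq> F}"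
    have "card ?S1 \<le> card ?P"
      by (rule card_mono[OF finite_families]) (use \<S>(2) assms(5) in auto)
    moreover have "real (card ?P) = gb q (dim (?X0 \<inter> ?X1) - t) 1"
      using card_subspaces_above[of E "?X0 \<inter> ?X1" "t + 1"] assms(4,5) EX
      by (simp add: subspace_inter)
    moreover have "gb q (dim (?X0 \<inter> ?X1) - t) 1 \<le> qint q (k - t)"
      unfolding One_nat_def gb_1 using dX01 by (intro qint_mono real_q_gt_1) auto
    ultimately show "real (card ?S1) \<le> qint q (k - t)" by linarith
  qed
  finally have 1: "real (card (\<Union>S'\<in>?S1. ?f S')) \<le> qint q (k - t) * B 1" .
  have "real (card (\<Union>S'\<in>?S2. ?f S')) \<le> real (card ?S2) * (c * B 2)"
  proof (rule card_le_sum_cover)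
    fix S' assume "S' \<in> ?S2"
    hence S': "subspace S'" "dim S' = t + 1" "E \<subseteq> S'" "\<not> S' \<subseteq> ?X1" using \<S>(2) assms(5) by auto
    have "dim (S' \<inter> G1) < t"
    proof (rule ccontr)
      assume "\<not> dim (S' \<inter> G1) < t"
      hence "dim (E \<inter> G1) < dim (S' \<inter> G1)" using assms(8) t_pos by linarith
      then obtain x where x: "x \<in> S' \<inter> G1" "x \<notin> E \<inter> G1"
        using exists_mem_diff_of_dim_less[OF subspace_inter[OF assms(4) G(4)]] by blast
      have "span (insert x E) = S'"
      proof (rule subspace_dim_equal)
        show "span (insert x E) \<subseteq> S'" using x S' by (intro span_minimal) auto
        show "dim S' \<le> dim (span (insert x E))" using dim_span_insert[of E x] x assms(4,5) S' by auto
      qed (use S' in auto)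
      moreover have "span (insert x E) \<subseteq> ?X1" using x by (intro span_mono) auto
      ultimately show False using S'(4) by blast
    qed
    hence "real (card (?f S')) \<le> qint q (dim G1 - t + 1) * B 2"
    proof (intro card_step)
      fix S'' assume S'': "subspace S''" "dim S'' = Suc (dim S')"
      have "card (?f S'') \<le> card (above \<F> S'')"
        by (rule card_mono[OF finite_families]) (auto simp: above_def)
      moreover have "real (card (above \<F> S'')) \<le> B 2"
        using S' S'' G k_ge by (intro card_above_le_B) auto
      ultimately show "real (card (?f S'')) \<le> B 2" by linarith
    qed (use S' G k_ge B_nonneg sub in auto)
    thus "real (card (?f S')) \<le> c * B 2" using G by simp
  qed auto
  also have "\<dots> \<le> c * (c * B 2)"
  proof (rule mult_right_mono)
    have "card ?S2 \<le> card \<S>" by (rule card_mono[OF finite_families]) auto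
    thus "real (card ?S2) \<le> c" using \<S>(1) G by simp
  qed (use c_nonneg B_nonneg in simp)
  finally have 2: "real (card (\<Union>S'\<in>?S2. ?f S')) \<le> c * (c * B 2)" .
  have "\<F> \<subseteq> D_fam scale \<F> G0 t \<union> D_fam scale \<F> G1 t \<union> ((\<Union>S'\<in>?S1. ?f S') \<union> (\<Union>S'\<in>?S2. ?f S'))"
  proof
    fix A assume A: "A \<in> \<F>"
    show "A \<in> D_fam scale \<F> G0 t \<union> D_fam scale \<F> G1 t \<union> ((\<Union>S'\<in>?S1. ?f S') \<union> (\<Union>S'\<in>?S2. ?f S'))"
    proof (cases "t \<le> dim (A \<inter> G0) \<and> t \<le> dim (A \<inter> G1)")
      case True
      then obtain S' where "S' \<in> \<S>" "S' \<subseteq> A" using \<S>(3)[of A] A sub assms(6) by blast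
      thus ?thesis using A True by blast
    qed (use A in \<open>auto simp: D_fam_def\<close>)
  qed
  hence "card \<F> \<le> card (D_fam scale \<F> G0 t \<union> D_fam scale \<F> G1 t \<union> ((\<Union>S'\<in>?S1. ?f S') \<union> (\<Union>S'\<in>?S2. ?f S')))"
    by (rule card_mono[OF finite_families])
  also have "\<dots> \<le> card (D_fam scale \<F> G0 t) + card (D_fam scale \<F> G1 t)
      + (card (\<Union>S'\<in>?S1. ?f S') + card (\<Union>S'\<in>?S2. ?f S'))"
    by (intro order_trans[OF card_Un_le] add_mono card_Un_le order_refl)
  finally show ?thesis using 1 2 G by linarith
qed

text \<open>The members of \<open>\<F>\<close> meeting \<open>X\<close> only in \<open>E\<close> are
  those that fail against the members of \<open>\<G>\<close> not through \<open>E\<close>, and they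
  fail against all of these at once. This is why both exceptional sets are bounded by
  \<open>s\<close> as soon as the first is nonempty.\<close>

definition star_like :: "'b set set \<Rightarrow> 'b set set \<Rightarrow> 'b set \<Rightarrow> 'b set \<Rightarrow> bool" where
  "star_like \<F> \<G> X E \<longleftrightarrow> subspace X \<and> dim X = k + 1 \<and> subspace E \<and> dim E = t \<and> E \<subseteq> X \<and>
     (\<forall>A\<in>\<F>. E \<subseteq> A) \<and> (\<forall>A\<in>\<G>. \<not> E \<subseteq> A \<longrightarrow> A \<subseteq> X) \<and>
     card {A \<in> \<F>. A \<inter> X = E} \<le> s \<and>
     ({A \<in> \<F>. A \<inter> X = E} = {} \<or> card {A \<in> \<G>. \<not> E \<subseteq> A} \<le> s)"

lemma card_le_of_common:
  assumes "almost_cross \<F> \<G>" "G \<in> \<G>" "subspace M" "dim M = t + 1" "\<And>A. A \<in> \<F> \<Longrightarrow> M \<subseteq> A" "dim (M \<inter> G) < t"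
  shows "real (card \<F>) \<le> real s + c * B 2"
proof -
  have G: "subspace G" "dim G = k" "card (D_fam scale \<F> G t) \<le> s" "\<F> \<subseteq> Gr"
    using assms(1,2) by (auto simp: almost_cross_def)
  have "real (card (above \<F> M)) \<le> real s + qint q (dim G - t + 1) * B 2"
  proof (rule card_above_step)
    show "real (card (above \<F> S')) \<le> B 2" if "subspace S'" "dim S' = Suc (dim M)" for S'
      using that assms(4) G k_ge by (intro card_above_le_B) auto
  qed (use G assms k_ge B_nonneg in auto)
  moreover have "above \<F> M = \<F>" using assms(5) by (auto simp: above_def)
  ultimately show ?thesis using G by simp
qed

lemma gb_t_Suc: "gb q (t + 1) t = qint q (t + 1)"
  using gb_Suc_self[OF real_q_gt_1, of t] by simp

lemma star_like_of_hyperplanes: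
  assumes P: "almost_cross \<F> \<G>" and E: "subspace E" "dim E = t" "\<And>A. A \<in> \<F> \<Longrightarrow> E \<subseteq> A"
    and G0: "G0 \<in> \<G>" "\<not> E \<subseteq> G0"
    and d: "\<And>G. G \<in> \<G> \<Longrightarrow> \<not> E \<subseteq> G \<Longrightarrow> dim (E \<inter> G) = t - 1"
    and X: "\<And>G. G \<in> \<G> \<Longrightarrow> \<not> E \<subseteq> G \<Longrightarrow> span (E \<union> G) = span (E \<union> G0)"
  shows "star_like \<F> \<G> (span (E \<union> G0)) E"
proof -
  let ?X = "span (E \<union> G0)"
  have G: "subspace G" "dim G = k" "card (D_fam scale \<F> G t) \<le> s" if "G \<in> \<G>" for G
    using P that by (auto simp: almost_cross_def)
  have F: "subspace A" "dim A = k" "card (D_fam scale \<G> A t) \<le> s" if "A \<in> \<F>" for A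
    using P that by (auto simp: almost_cross_def)
  have EX: "E \<subseteq> ?X" by (auto intro: span_base)
  have GX: "A \<subseteq> ?X" if "A \<in> \<G>" "\<not> E \<subseteq> A" for A
    using X[OF that] span_superset[of "E \<union> A"] by auto
  have dX: "dim ?X = k + 1" by (rule dim_span_Un_hyperplane) (use E G0 G d in auto)
  \<comment> \<open>\<open>G\<close> is a hyperplane of \<open>?X\<close>: if \<open>A\<close> meets
    \<open>?X\<close> in dimension at least \<open>t + 1\<close>, it meets \<open>G\<close> in
    dimension at least \<open>t\<close>; if it meets \<open>?X\<close> in \<open>E\<close>, only
    \<open>E \<inter> G\<close> of dimension \<open>t - 1\<close> remains.\<close>
  have iff: "dim (A \<inter> G) < t \<longleftrightarrow> A \<inter> ?X = E" if A: "A \<in> \<F>" and "G \<in> \<G>" "\<not> E \<subseteq> G" for A G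
  proof
    assume "A \<inter> ?X = E"
    hence "A \<inter> G \<subseteq> E \<inter> G" using GX that by auto
    hence "dim (A \<inter> G) \<le> dim (E \<inter> G)" by (rule dim_subset)
    thus "dim (A \<inter> G) < t" using d[OF that(2,3)] t_pos by linarith
  next
    assume lt: "dim (A \<inter> G) < t"
    show "A \<inter> ?X = E"
    proof (rule ccontr)
      assume ne: "A \<inter> ?X \<noteq> E"
      have AX: "subspace (A \<inter> ?X)" using F A by (auto intro: subspace_inter)
      have "\<not> dim (A \<inter> ?X) \<le> dim E"
        using subspace_dim_equal[OF E(1) AX] E(3)[OF A] EX ne by auto
      moreover have "dim (span ((A \<inter> ?X) \<union> G)) \<le> dim ?X"
        using GX[OF that(2,3)] by (intro dim_subset span_minimal) auto
      moreover have "A \<inter> ?X \<inter> G = A \<inter> G" using GX[OF that(2,3)] by auto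
      ultimately show False
        using dim_span_Un[OF AX G(1)[OF that(2)]] G(2)[OF that(2)] dX E(2) lt by simp
    qed
  qed
  have "{A \<in> \<F>. A \<inter> ?X = E} \<subseteq> D_fam scale \<F> G0 t"
    using iff G0 by (auto simp: D_fam_def)
  hence "card {A \<in> \<F>. A \<inter> ?X = E} \<le> card (D_fam scale \<F> G0 t)" by (rule card_mono[OF finite_families])
  hence 1: "card {A \<in> \<F>. A \<inter> ?X = E} \<le> s" using G(3)[OF G0(1)] by linarith
  have 2: "card {G \<in> \<G>. \<not> E \<subseteq> G} \<le> s" if ne: "{A \<in> \<F>. A \<inter> ?X = E} \<noteq> {}"
  proof -
    obtain A where A: "A \<in> \<F>" "A \<inter> ?X = E" using ne by blast
    have "{G \<in> \<G>. \<not> E \<subseteq> G} \<subseteq> D_fam scale \<G> A t"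
    proof
      fix G assume "G \<in> {G \<in> \<G>. \<not> E \<subseteq> G}"
      thus "G \<in> D_fam scale \<G> A t" using iff[of A G] A by (auto simp: D_fam_def Int_commute)
    qed
    hence "card {G \<in> \<G>. \<not> E \<subseteq> G} \<le> card (D_fam scale \<G> A t)" by (rule card_mono[OF finite_families])
    thus ?thesis using F(3)[OF A(1)] by linarith
  qed
  show ?thesis unfolding star_like_def using dX E EX GX 1 2 by blast
qed

text \<open>At level 1, a common \<open>(t + 1)\<close>-space of \<open>\<F>\<close> leads to
  \<open>flag\<close> or \<open>common\<close>, according to whether it covers \<open>\<G>\<close>.
  Without one, \<open>\<G>\<close> consists mostly of spaces through \<open>E\<close>, and the
  position of the others relative to \<open>E\<close> decides: some meets \<open>E\<close> in
  codimension at least 2 (\<open>far\<close>), they span different spaces with \<open>E\<close>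
  (\<open>spread\<close>), or all span the same \<open>X\<close> (\<open>star\<close>).\<close>

lemma cover_cases:
  assumes P: "almost_cross \<F> \<G>" and E: "subspace E" "dim E = t" "\<And>A. A \<in> \<F> \<Longrightarrow> E \<subseteq> A"
    and nonempty: "\<F> \<noteq> {}" and G_cov: "\<not> is_cover \<G> 0"
  obtains (level) j where "2 \<le> j" "t + j \<le> k" "real (card \<F>) \<le> \<phi> j"
      "real (card \<G>) \<le> 2 * (gb q (t + j) t * max (real s) (B 0))"
  | (common) "real (card \<F>) \<le> real s + c * B 2" "real (card \<G>) \<le> qint q (t + 1) * B 0"
  | (flag) L where "subspace L" "dim L = t + 1" "\<And>A. A \<in> \<F> \<Longrightarrow> L \<subseteq> A" "\<And>A. A \<in> \<G> \<Longrightarrow> t \<le> dim (A \<inter> L)"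
  | (far) "real (card \<F>) \<le> real s + c * (c * B 2)"
      "real (card \<G>) \<le> B 0 + qint q (t + 1) * (real s + c * B 1)"
  | (spread) "real (card \<F>) \<le> 2 * real s + qint q (k - t) * B 1 + c * (c * B 2)"
      "real (card \<G>) \<le> B 0 + qint q (t + 1) * (real s + c * B 1)"
  | (star) X where "star_like \<F> \<G> X E"
proof -
  have sub: "\<F> \<subseteq> Gr" "\<G> \<subseteq> Gr" using P by (auto simp: almost_cross_def)
  have aboveE: "above \<F> E = \<F>" using E(3) by (auto simp: above_def)
  have B0: "real (card (above \<G> S)) \<le> B 0" if "subspace S" "dim S = t" for S
    using that sub(2) k_ge by (intro card_above_le_B) auto
  have G_ne: "\<G> \<noteq> {}"
    using G_cov E(1,2) by (auto simp: is_cover_def)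
  obtain j where j: "1 \<le> j" "t + j \<le> k" "is_cover \<G> j \<or> j = k - t"
    "\<And>T. subspace T \<Longrightarrow> dim T < t + j \<Longrightarrow> \<exists>G\<in>\<G>. dim (T \<inter> G) < t"
    by (rule obtain_level[OF G_ne G_cov]) blast
  show ?thesis
  proof (cases "j = 1")
    case False
    have "real (card \<F>) \<le> \<phi> j"
      using card_above_\<phi>[OF P j(2) E(1,2) j(4)] aboveE by simp
    moreover have "real (card \<G>) \<le> 2 * (gb q (t + j) t * max (real s) (B 0))"
      by (rule card_le_level[OF P nonempty j(3,2)]) (auto intro: order_trans[OF B0])
    ultimately show ?thesis using level[of j] False j(1,2) by linarith
  next
    case True
    hence "is_cover \<G> 1" using j(3) k_ge by auto
    then obtain L where L: "subspace L" "dim L = t + 1" "\<And>G. G \<in> \<G> \<Longrightarrow> t \<le> dim (G \<inter> L)"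
      by (auto simp: is_cover_def)
    show ?thesis
    proof (cases "\<exists>M. subspace M \<and> dim M = t + 1 \<and> (\<forall>A\<in>\<F>. M \<subseteq> A)")
      case True
      then obtain M where M: "subspace M" "dim M = t + 1" "\<And>A. A \<in> \<F> \<Longrightarrow> M \<subseteq> A" by blast
      show ?thesis
      proof (cases "\<forall>A\<in>\<G>. t \<le> dim (A \<inter> M)")
        case True
        thus ?thesis using flag[OF M] by blast
      next
        case False
        then obtain G where G: "G \<in> \<G>" "dim (M \<inter> G) < t" by (auto simp: not_le Int_commute)
        have "real (card \<G>) \<le> gb q (dim L) t * B 0"
          using sub(2) L B0 by (intro card_le_cover) auto
        hence "real (card \<G>) \<le> qint q (t + 1) * B 0" using L(2) gb_t_Suc by simp
        thus ?thesis using common card_le_of_common[OF P G(1) M G(2)] by blast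
      qed
    next
      case no_M: False
      \<comment> \<open>If \<open>S\<close> were contained in all members of \<open>\<F>\<close>, so
        would be the span of \<open>E\<close> and \<open>S\<close>, which contains a common
        \<open>(t + 1)\<close>-space. Hence some member misses \<open>S\<close>, and
        \<open>E\<close> is the only t-space through which \<open>\<G>\<close> can have more than
        \<open>s + c * B 1\<close> members.\<close>
      have S: "real (card (above \<G> S)) \<le> real s + c * B 1" if S: "subspace S" "dim S = t" "S \<noteq> E" for S
      proof -
        have "\<exists>A\<in>\<F>. \<not> S \<subseteq> A"
        proof (rule ccontr)
          assume "\<not> (\<exists>A\<in>\<F>. \<not> S \<subseteq> A)"
          hence sA: "span (E \<union> S) \<subseteq> A" if "A \<in> \<F>" for A
            using that E(3)[OF that] sub(1) by (intro span_minimal) auto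
          have "\<not> S \<subseteq> E" using subspace_dim_equal[OF S(1) E(1)] S E(2) by auto
          hence "dim (S \<inter> E) < t" using dim_Int_less[OF S(1,2) E(1)] by blast
          hence "t + 1 \<le> dim (span (E \<union> S))"
            using dim_span_Un[OF E(1) S(1)] E(2) S(2) by (simp add: Int_commute)
          then obtain M where M: "subspace M" "M \<subseteq> span (E \<union> S)" "dim M = t + 1"
            by (rule exists_subspace_of_dim[OF subspace_span])
          thus False using no_M sA by blast
        qed
        then obtain A where "A \<in> \<F>" "\<not> S \<subseteq> A" by blast
        thus ?thesis using card_above_t[OF almost_cross_sym[OF P]] S by blast
      qed
      define \<G>' where "\<G>' = {G \<in> \<G>. \<not> E \<subseteq> G}"
      have "real (card \<G>') \<le> gb q (dim L) t * (real s + c * B 1)"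
      proof (rule card_le_cover[OF L(1)])
        fix S assume S': "subspace S" "dim S = t"
        show "real (card (above \<G>' S)) \<le> real s + c * B 1"
        proof (cases "S = E")
          case True
          hence "above \<G>' S = {}" by (auto simp: above_def \<G>'_def)
          thus ?thesis using c_nonneg B_nonneg by simp
        next
          case False
          have "card (above \<G>' S) \<le> card (above \<G> S)"
            by (rule card_mono[OF finite_families]) (auto simp: above_def \<G>'_def)
          thus ?thesis using S[OF S' False] by linarith
        qed
      qed (use L sub in \<open>auto simp: \<G>'_def\<close>)
      moreover have "above \<G> E \<union> \<G>' = \<G>" by (auto simp: above_def \<G>'_def)
      hence "card \<G> \<le> card (above \<G> E) + card \<G>'"
        using card_Un_le[of "above \<G> E" \<G>'] by simp
      ultimately have card_G: "real (card \<G>) \<le> B 0 + qint q (t + 1) * (real s + c * B 1)"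
        using B0[OF E(1,2)] L(2) gb_t_Suc by simp
      show ?thesis
      proof (cases "\<exists>G\<in>\<G>. dim (E \<inter> G) + 2 \<le> t")
        case True
        then obtain G where "G \<in> \<G>" "dim (E \<inter> G) + 2 \<le> t" by blast
        thus ?thesis using far card_G card_le_two_steps[OF P _ E] by blast
      next
        case False
        have d: "dim (E \<inter> G) = t - 1" if "G \<in> \<G>" "\<not> E \<subseteq> G" for G
        proof -
          have "subspace G" using that(1) sub(2) by auto
          hence "dim (E \<inter> G) < t" using dim_Int_less[OF E(1,2)] that(2) by blast
          moreover have "\<not> dim (E \<inter> G) + 2 \<le> t" using False that(1) by blast
          ultimately show ?thesis by linarith
        qed
        have "\<not> (\<forall>G\<in>\<G>. t \<le> dim (G \<inter> E))" using G_cov E(1,2) by (auto simp: is_cover_def)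
        then obtain G0 where G0: "G0 \<in> \<G>" "\<not> t \<le> dim (G0 \<inter> E)" by blast
        have G0': "\<not> E \<subseteq> G0"
        proof
          assume "E \<subseteq> G0"
          hence "G0 \<inter> E = E" by auto
          thus False using G0(2) E(2) by simp
        qed
        show ?thesis
        proof (cases "\<exists>G\<in>\<G>. \<not> E \<subseteq> G \<and> span (E \<union> G) \<noteq> span (E \<union> G0)")
          case True
          then obtain G1 where G1: "G1 \<in> \<G>" "\<not> E \<subseteq> G1" "span (E \<union> G1) \<noteq> span (E \<union> G0)" by blast
          have "real (card \<F>) \<le> 2 * real s + qint q (k - t) * B 1 + c * (c * B 2)"
            by (rule card_le_two_hyperplanes[OF P G1(1) G0(1) E d[OF G1(1,2)] d[OF G0(1) G0'] G1(3)])
          thus ?thesis using spread card_G by blast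
        next
          case False
          thus ?thesis using star[OF star_like_of_hyperplanes[OF P E G0(1) G0' d]] by blast
        qed
      qed
    qed
  qed
qed

section \<open>Estimates for large \<open>n\<close>\<close>

abbreviation R :: real where "R \<equiv> real q ^ (n - k)"

lemma Q1: "1 \<le> real q"
  using real_q_ge_2 by simp

lemma n_large: "3 * k + 3 * t + 2 \<le> n"
proof (rule ccontr)
  assume "\<not> 3 * k + 3 * t + 2 \<le> n"
  hence "real q ^ n \<le> real q ^ (3 * k + 3 * t + 1)" using Q1 by (intro power_increasing) auto
  moreover have "0 < real q ^ (3 * k + 3 * t + 1)" using Q1 by (intro zero_less_power) auto
  moreover have "1 \<le> real s" using s_pos by simp
  hence "13 * real q ^ (3 * k + 3 * t + 1) \<le> 13 * real s * real q ^ (3 * k + 3 * t + 1)"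
    using Q1 by (intro mult_right_mono) auto
  ultimately show False using n_ge by linarith
qed

lemma R_ge: "13 * real s * real q ^ (2 * k + 3 * t + 1) \<le> R"
proof -
  have "real q ^ (2 * k + 3 * t + 1) * real q ^ k = real q ^ (3 * k + 3 * t + 1)"
    "R * real q ^ k = real q ^ n"
    using n_large by (simp_all flip: power_add)
  hence "(13 * real s * real q ^ (2 * k + 3 * t + 1)) * real q ^ k \<le> R * real q ^ k"
    using n_ge by (simp only: mult.assoc)
  thus ?thesis by (rule mult_right_le_imp_le) (use Q1 in auto)
qed

text \<open>\<open>b\<close> spare powers of \<open>q\<close> are traded for factors 2; this is
  where the numerical slack of the later estimates comes from.\<close>

lemma R_ge_s_power:
  assumes "a + b \<le> 2 * k + 3 * t + 1" shows "13 * 2 ^ b * real s * real q ^ a \<le> R"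
proof -
  have "(2::real) ^ b * real q ^ a \<le> real q ^ b * real q ^ a"
    using real_q_ge_2 by (intro mult_right_mono power_mono) auto
  also have "\<dots> \<le> real q ^ (2 * k + 3 * t + 1)"
    unfolding power_add[symmetric] using Q1 assms by (intro power_increasing) auto
  finally have "13 * real s * (2 ^ b * real q ^ a) \<le> 13 * real s * real q ^ (2 * k + 3 * t + 1)"
    by (intro mult_left_mono) auto
  thus ?thesis using R_ge by (simp add: mult_ac)
qed

lemma s_ge_1: "1 \<le> real s"
  using s_pos by simp

lemma R_ge_power:
  assumes "a + b \<le> 2 * k + 3 * t + 1" shows "13 * 2 ^ b * real q ^ a \<le> R"
proof -
  have "13 * 2 ^ b * 1 * real q ^ a \<le> 13 * 2 ^ b * real s * real q ^ a"
    using s_ge_1 by (intro mult_right_mono mult_left_mono) auto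
  thus ?thesis using R_ge_s_power[OF assms] by linarith
qed

lemma R_pos: "0 < R"
  using Q1 by simp

lemma B_pos: "0 < B i"
  unfolding B_def using n_large by (intro gb_pos real_q_gt_1) auto

lemma B_ratio:
  assumes "t + i < k" shows "R * B (Suc i) \<le> B i"
proof -
  have "real q ^ (n - (t + Suc i) - (k - (t + Suc i))) * gb q (n - (t + Suc i)) (k - (t + Suc i))
      \<le> gb q (Suc (n - (t + Suc i))) (Suc (k - (t + Suc i)))"
    by (rule gb_ratio[OF real_q_gt_1]) (use n_large in auto)
  moreover have "Suc (n - (t + Suc i)) = n - (t + i)" "Suc (k - (t + Suc i)) = k - (t + i)"
    "n - (t + Suc i) - (k - (t + Suc i)) = n - k" using assms n_large by auto
  ultimately show ?thesis by (simp add: B_def)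
qed

lemma B_ge_power: "t + i \<le> k \<Longrightarrow> R ^ (k - t - i) \<le> B i"
proof (induction "k - t - i" arbitrary: i)
  case 0
  hence "k - (t + i) = 0" "k - t - i = 0" by auto
  thus ?case unfolding B_def by (simp only: gb_0 power_0)
next
  case (Suc d)
  have d: "d = k - t - Suc i" "k - t - i = Suc d" using Suc by auto
  have "R ^ Suc d \<le> R * B (Suc i)"
    using Suc.hyps(1)[of "Suc i"] d Suc.prems R_pos by (auto intro!: mult_left_mono)
  also have "\<dots> \<le> B i" using d by (intro B_ratio) auto
  finally show ?case using d by simp
qed

lemma B_decay: "t + Suc j \<le> k \<Longrightarrow> R ^ j * B (Suc j) \<le> B 1"
proof (induction j)
  case (Suc j)
  have "R ^ Suc j * B (Suc (Suc j)) = R ^ j * (R * B (Suc (Suc j)))" by simp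
  also have "\<dots> \<le> R ^ j * B (Suc j)"
    using Suc.prems R_pos by (intro mult_left_mono B_ratio) auto
  also have "\<dots> \<le> B 1" using Suc by simp
  finally show ?case .
qed simp

lemma R_le_B1: "R \<le> B 1"
proof -
  have "R ^ 1 \<le> R ^ (k - t - 1)"
    using k_ge Q1 by (intro power_increasing one_le_power) auto
  thus ?thesis using B_ge_power[of 1] k_ge by simp
qed

lemma R_B1: "R * B 1 \<le> B 0" and R_B2: "R * B 2 \<le> B 1"
  using B_ratio[of 0] B_ratio[of 1] k_ge by (auto simp: numeral_2_eq_2)

lemma mult_B_le:
  assumes "x * y \<le> R" "R * b \<le> a" "0 \<le> b" shows "x * (y * b) \<le> a"
  using mult_right_mono[OF assms(1,3)] assms(2) by (simp add: mult_ac)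

lemma c_le: "c \<le> real q ^ (k - t + 1)"
  by (rule qint_le_power[OF real_q_ge_2])

lemma c_ge_1: "1 \<le> c"
  using power_le_qint_Suc[OF real_q_gt_1, of "k - t"] one_le_power[OF Q1, of "k - t"] by simp

lemma s_small: "1000 * real s \<le> B 1"
proof -
  have "13 * 2 ^ 8 * real s * real q ^ 0 \<le> R" using k_ge t_pos by (intro R_ge_s_power) simp
  thus ?thesis using R_le_B1 by simp
qed

lemma cB2_small: "1000 * (c * B 2) \<le> B 1"
proof -
  have "13 * 2 ^ 7 * real q ^ (k - t + 1) \<le> R" using k_ge t_pos by (intro R_ge_power) simp
  moreover have "1000 * c \<le> 13 * 2 ^ 7 * real q ^ (k - t + 1)" using c_le c_nonneg by simp
  ultimately show ?thesis using B_nonneg by (intro mult_B_le[OF _ R_B2]) auto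
qed

lemma ccB2_small: "200 * (c * (c * B 2)) \<le> B 1"
proof -
  have "c * c \<le> real q ^ (k - t + 1) * real q ^ (k - t + 1)"
    using c_le c_nonneg by (intro mult_mono) auto
  hence "c * c \<le> real q ^ (2 * (k - t + 1))" by (simp only: mult_2 power_add)
  moreover have "13 * 2 ^ 4 * real q ^ (2 * (k - t + 1)) \<le> R" using k_ge t_pos by (intro R_ge_power) simp
  hence "208 * real q ^ (2 * (k - t + 1)) \<le> R" by simp
  moreover have "0 \<le> real q ^ (2 * (k - t + 1))" by simp
  ultimately have "200 * (c * c) \<le> R" by linarith
  thus ?thesis using mult_B_le[OF _ R_B2 B_nonneg, of 200 "c * c"] by (simp add: mult_ac)
qed

text \<open>The members of \<open>\<G>\<close> not through \<open>E\<close> in the cases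
  \<open>far\<close> and \<open>spread\<close> are negligible against the bound \<open>B 0\<close>
  for those through \<open>E\<close>.\<close>

lemma G_extra_small: "200 * (qint q (t + 1) * (real s + c * B 1)) \<le> B 0"
proof -
  have "real s + c * B 1 \<le> (2 * real q ^ (k - t + 1)) * B 1"
  proof -
    have "real s \<le> real q ^ (k - t + 1) * B 1"
      using s_small mult_right_mono[OF one_le_power[OF Q1, of "k - t + 1"] B_nonneg[of 1]] by linarith
    thus ?thesis using mult_right_mono[OF c_le B_nonneg[of 1]] by linarith
  qed
  hence "qint q (t + 1) * (real s + c * B 1) \<le> real q ^ (t + 1) * ((2 * real q ^ (k - t + 1)) * B 1)"
    using qint_le_power[OF real_q_ge_2, of "t + 1"] qint_nonneg[OF real_q_gt_1] c_nonneg B_nonneg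
    by (intro mult_mono) auto
  also have "\<dots> = 2 * real q ^ (k + 2) * B 1"
    using k_ge by (simp flip: power_add power_Suc)
  finally have "qint q (t + 1) * (real s + c * B 1) \<le> 2 * (real q ^ (k + 2) * B 1)" by simp
  moreover have "13 * 2 ^ 5 * real q ^ (k + 2) \<le> R" using k_ge t_pos by (intro R_ge_power) simp
  hence "400 * (real q ^ (k + 2) * B 1) \<le> B 0"
    by (intro mult_B_le[OF _ R_B1]) (auto simp: B_nonneg intro: order_trans[rotated])
  ultimately show ?thesis by linarith
qed

lemma sum_c_le: "1 \<le> j \<Longrightarrow> (\<Sum>i<j. c ^ i) \<le> 2 * (real q ^ (k - t + 1)) ^ (j - 1)"
proof (induction j)
  case (Suc j)
  show ?case
  proof (cases "j = 0")
    case False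
    let ?p = "real q ^ (k - t + 1)"
    have "real q ^ 1 \<le> ?p" using Q1 by (intro power_increasing) auto
    hence "2 \<le> ?p" using real_q_ge_2 unfolding power_one_right by linarith
    hence "2 * ?p ^ (j - 1) \<le> ?p * ?p ^ (j - 1)" by (intro mult_right_mono) auto
    also have "\<dots> = ?p ^ j" using False by (simp flip: power_Suc)
    finally have "(\<Sum>i<j. c ^ i) \<le> ?p ^ j" using Suc.IH False by linarith
    moreover have "c ^ j \<le> ?p ^ j" using c_le c_nonneg by (rule power_mono)
    ultimately show ?thesis by simp
  qed simp
qed simp

text \<open>Each level costs \<open>q ^ t\<close> through the choice of a t-space in the cover and
  \<open>q ^ (k - t + 1)\<close> through \<open>c\<close>, together \<open>q ^ (k + 1)\<close>. Both
  sides carry a factor \<open>R\<close> so that the decay of the \<open>B j\<close> applies without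
  division.\<close>

lemma level_bound:
  assumes "1 \<le> j" "t + j \<le> k"
  shows "R * (gb q (t + j) t * \<phi> j)
    \<le> real q ^ t * (real q ^ (k + 1)) ^ j * (R * B j) + 2 * real s * real q ^ (2 * t + k + 1) * B 1"
proof -
  let ?p = "real q ^ (k - t + 1)"
  have cj: "c ^ j \<le> ?p ^ j" using c_le c_nonneg by (rule power_mono)
  have "\<phi> j \<le> ?p ^ j * B j + real s * (2 * ?p ^ (j - 1))"
    unfolding \<phi>_def using sum_c_le[OF assms(1)] cj B_nonneg
    by (intro add_mono mult_right_mono mult_left_mono) auto
  hence "gb q (t + j) t * \<phi> j \<le> real q ^ (t * (j + 1)) * (?p ^ j * B j + real s * (2 * ?p ^ (j - 1)))"
    using gb_le_power[OF real_q_ge_2, of t j] \<phi>_nonneg Q1 by (intro mult_mono) auto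
  also have "\<dots> = real q ^ t * (real q ^ (k + 1)) ^ j * B j
      + 2 * real s * (real q ^ (2 * t) * (real q ^ (k + 1)) ^ (j - 1))"
  proof -
    obtain i where i: "j = Suc i" using assms(1) by (cases j) auto
    have "(real q ^ (k + 1)) ^ l = (real q ^ t) ^ l * ?p ^ l" for l
      using k_ge by (simp flip: power_mult_distrib power_add power_Suc)
    moreover have "t * (j + 1) = t + t * j" "t * (j + 1) = 2 * t + t * (j - 1)"
      by (simp_all add: i algebra_simps)
    hence "real q ^ (t * (j + 1)) = real q ^ t * (real q ^ t) ^ j"
      "real q ^ (t * (j + 1)) = real q ^ (2 * t) * (real q ^ t) ^ (j - 1)"
      by (metis power_add power_mult)+
    ultimately show ?thesis by (simp only: distrib_left) (simp add: mult_ac)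
  qed
  finally have "R * (gb q (t + j) t * \<phi> j) \<le> R * (real q ^ t * (real q ^ (k + 1)) ^ j * B j
      + 2 * real s * (real q ^ (2 * t) * (real q ^ (k + 1)) ^ (j - 1)))"
    using R_pos by (intro mult_left_mono) auto
  \<comment> \<open>One of the at most \<open>k - t - 1\<close> powers of \<open>q ^ (k + 1)\<close>
    is kept and the others are raised to \<open>R\<close>; with the \<open>R\<close> in front this
    gives \<open>R ^ (k - t - 1)\<close>, which is at most \<open>B 1\<close>.\<close>
  moreover have "R * (real q ^ (k + 1)) ^ (j - 1) \<le> real q ^ (k + 1) * B 1"
  proof -
    have le: "real q ^ (k + 1) \<le> R" using n_large Q1 by (intro power_increasing) auto
    obtain p where p: "k - t - 1 = Suc p" using k_ge by (cases "k - t - 1") auto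
    have "(real q ^ (k + 1)) ^ (j - 1) \<le> (real q ^ (k + 1)) ^ Suc p"
      using assms p Q1 by (intro power_increasing one_le_power) auto
    also have "\<dots> \<le> real q ^ (k + 1) * R ^ p"
      using le Q1 by (auto intro!: mult_left_mono power_mono)
    finally have "R * (real q ^ (k + 1)) ^ (j - 1) \<le> R * (real q ^ (k + 1) * R ^ p)"
      using R_pos by (intro mult_left_mono) auto
    also have "\<dots> = real q ^ (k + 1) * R ^ (k - t - 1)" using p by simp
    also have "\<dots> \<le> real q ^ (k + 1) * B 1"
      using B_ge_power[of 1] k_ge Q1 by (intro mult_left_mono) auto
    finally show ?thesis .
  qed
  hence "2 * real s * real q ^ (2 * t) * (R * (real q ^ (k + 1)) ^ (j - 1))
      \<le> 2 * real s * real q ^ (2 * t) * (real q ^ (k + 1) * B 1)"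
    by (intro mult_left_mono) auto
  ultimately show ?thesis by (simp add: algebra_simps power_add)
qed

lemma level_tail: "200 * (real s * real q ^ (2 * t + k + 1) * B 1) \<le> R * B 1"
proof -
  have "13 * 2 ^ 4 * real s * real q ^ (2 * t + k + 1) \<le> R" using k_ge t_pos by (intro R_ge_s_power) simp
  hence "208 * (real s * real q ^ (2 * t + k + 1)) \<le> R" by (simp add: mult.assoc)
  moreover have "0 \<le> real s * real q ^ (2 * t + k + 1)" using Q1 by simp
  ultimately have "200 * (real s * real q ^ (2 * t + k + 1)) \<le> R" by linarith
  hence "200 * (real s * real q ^ (2 * t + k + 1)) * B 1 \<le> R * B 1"
    by (intro mult_right_mono B_nonneg)
  thus ?thesis by (simp add: mult_ac)
qed

lemma level_bound_1:
  assumes "1 \<le> j" "t + j \<le> k"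
  shows "gb q (t + j) t * \<phi> j \<le> 101 / 100 * (real q ^ (t + k + 1) * B 1)"
proof -
  obtain i where i: "j = Suc i" using assms(1) by (cases j) auto
  have le: "real q ^ (k + 1) \<le> R" using n_large Q1 by (intro power_increasing) auto
  have "(real q ^ (k + 1)) ^ i * B j \<le> R ^ i * B j"
    using le Q1 B_nonneg by (intro mult_right_mono power_mono) auto
  also have "\<dots> \<le> B 1" using B_decay[of i] assms i by simp
  finally have "real q ^ t * real q ^ (k + 1) * (R * ((real q ^ (k + 1)) ^ i * B j)) \<le> real q ^ t * real q ^ (k + 1) * (R * B 1)"
    using Q1 by (intro mult_left_mono) auto
  hence 1: "real q ^ t * (real q ^ (k + 1)) ^ j * (R * B j) \<le> R * (real q ^ (t + k + 1) * B 1)"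
    by (simp add: i power_add mult_ac)
  have "R * B 1 \<le> R * (real q ^ (t + k + 1) * B 1)"
    using mult_right_mono[OF one_le_power[OF Q1, of "t + k + 1"] B_nonneg[of 1]] R_pos
    by (intro mult_left_mono) auto
  hence "R * (gb q (t + j) t * \<phi> j) \<le> R * (101 / 100 * (real q ^ (t + k + 1) * B 1))"
    using level_bound[OF assms] 1 level_tail by (simp add: mult.assoc)
  thus ?thesis using R_pos by (rule mult_left_le_imp_le)
qed

text \<open>From level 2 on, \<open>B j\<close> leaves one factor \<open>R\<close> to set against
  \<open>q ^ (t + 2 * (k + 1))\<close>. This gains the constant \<open>1 / 26\<close>, and the terms
  with \<open>s\<close> add at most \<open>1 / 100\<close>.\<close>

lemma level_bound_2:
  assumes "2 \<le> j" "t + j \<le> k" shows "gb q (t + j) t * \<phi> j \<le> B 1 / 10"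
proof -
  obtain i where i: "j = Suc (Suc i)" using assms(1) by (metis add_2_eq_Suc le_Suc_ex)
  have le: "real q ^ (k + 1) \<le> R" using n_large Q1 by (intro power_increasing) auto
  have "(real q ^ (k + 1)) ^ i * (R * B j) \<le> R ^ i * (R * B j)"
    using le Q1 B_nonneg R_pos by (intro mult_right_mono power_mono) auto
  also have "\<dots> = R ^ Suc i * B j" by simp
  also have "\<dots> \<le> B 1" using B_decay[of "Suc i"] assms i by simp
  finally have "real q ^ (t + 2 * (k + 1)) * ((real q ^ (k + 1)) ^ i * (R * B j)) \<le> real q ^ (t + 2 * (k + 1)) * B 1"
    using Q1 by (intro mult_left_mono) auto
  moreover have "real q ^ (t + 2 * (k + 1)) * ((real q ^ (k + 1)) ^ i * (R * B j))
      = real q ^ t * (real q ^ (k + 1)) ^ j * (R * B j)"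
  proof -
    have "real q ^ (t + 2 * (k + 1)) = real q ^ t * (real q ^ (k + 1) * real q ^ (k + 1))"
      by (simp only: power_add mult_2)
    thus ?thesis by (simp only: i power_Suc mult_ac)
  qed
  moreover have "13 * 2 ^ 1 * real q ^ (t + 2 * (k + 1)) \<le> R" using t_pos by (intro R_ge_power) simp
  hence "26 * real q ^ (t + 2 * (k + 1)) * B 1 \<le> R * B 1"
    using B_nonneg by (intro mult_right_mono) auto
  ultimately have "R * (gb q (t + j) t * \<phi> j) \<le> R * (B 1 / 10)"
  proof -
    assume 1: "real q ^ (t + 2 * (k + 1)) * ((real q ^ (k + 1)) ^ i * (R * B j)) \<le> real q ^ (t + 2 * (k + 1)) * B 1"
      and 2: "real q ^ (t + 2 * (k + 1)) * ((real q ^ (k + 1)) ^ i * (R * B j))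
        = real q ^ t * (real q ^ (k + 1)) ^ j * (R * B j)"
      and 3: "26 * real q ^ (t + 2 * (k + 1)) * B 1 \<le> R * B 1"
    have "1 \<le> j" using assms(1) by simp
    from level_bound[OF this assms(2)] 1 3 level_tail mult_pos_pos[OF R_pos B_pos[of 1]]
    show ?thesis unfolding 2 by linarith
  qed
  thus ?thesis using R_pos by (rule mult_left_le_imp_le)
qed

text \<open>Leading coefficient, in units of \<open>B 0 * B 1\<close>, of the larger of
  \<open>G1\<close> and \<open>G2\<close> below. It equals \<open>qint q (t + 1)\<close> for
  \<open>k \<le> 2 * t\<close> and \<open>c\<close> otherwise, so both ranges of \<open>k\<close>
  share one threshold.\<close>

definition main_coeff :: real where "main_coeff = max c (qint q (t + 1))"

text \<open>\<open>gb_shift (n - t) (k - t) i\<close> is the number of \<open>k\<close>-spaces that meet a given \<open>(t + i)\<close>-space \<open>X\<^sub>i \<supseteq> E\<close>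
  exactly in \<open>E\<close>. Telescoping along a flag of such spaces evaluates the count \<open>A1\<close> below of those
  \<open>k\<close>-spaces through \<open>E\<close> that meet \<open>X\<close> in more than \<open>E\<close>.\<close>

definition gb_shift :: "nat \<Rightarrow> nat \<Rightarrow> nat \<Rightarrow> real" where
  "gb_shift a b i = real q ^ (b * i) * gb q (a - i) b"

lemma gb_shift_0: "gb_shift a b 0 = gb q a b"
  by (simp add: gb_shift_def)

text \<open>An instance of Pascal's rule. For \<open>a = n - t\<close> and
  \<open>Suc b = k - t\<close> the difference counts the spaces meeting X_i only in \<open>E\<close>
  but X_(i+1) in more: this larger intersection is one of the \<open>q ^ i\<close> spaces of
  dimension \<open>t + 1\<close> that contain \<open>E\<close> and lie in X_(i+1) but not in
  X_i.\<close>

lemma gb_shift_diff: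
  assumes "Suc i + b \<le> a"
  shows "gb_shift a (Suc b) i - gb_shift a (Suc b) (Suc i) = real q ^ i * gb_shift (a - 1) b i"
proof -
  have "a - i = Suc (a - Suc i)" using assms by simp
  hence "gb q (a - i) (Suc b) = real q ^ Suc b * gb q (a - Suc i) (Suc b) + gb q (a - Suc i) b"
    using gb_Pascal[OF real_q_gt_1, of b "a - Suc i"] assms by simp
  moreover have "real q ^ (Suc b * Suc i) = real q ^ (Suc b * i) * real q ^ Suc b"
    by (simp add: power_add mult_ac)
  ultimately have "gb_shift a (Suc b) i - gb_shift a (Suc b) (Suc i) = real q ^ (Suc b * i) * gb q (a - Suc i) b"
    unfolding gb_shift_def by (simp only: distrib_left mult.assoc add_diff_cancel_left')
  thus ?thesis by (simp add: gb_shift_def power_add)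
qed

lemma gb_shift_diff':
  assumes "0 < b" "i + b \<le> a"
  shows "gb_shift a b i - gb_shift a b (Suc i) = real q ^ i * gb_shift (a - 1) (b - 1) i"
  using gb_shift_diff[of i "b - 1" a] assms by simp

lemma gb_shift_nonneg: "0 \<le> gb_shift a b i"
  unfolding gb_shift_def using gb_nonneg[OF real_q_gt_1] Q1 by (intro mult_nonneg_nonneg) auto

lemma gb_shift_antimono: "i + b \<le> a \<Longrightarrow> gb_shift a b i \<le> gb_shift a b 0"
proof (induction i)
  case (Suc i)
  show ?case
  proof (cases b)
    case 0
    thus ?thesis by (simp add: gb_shift_def)
  next
    case (Suc b')
    have "gb_shift a b (Suc i) \<le> gb_shift a b i"
      using gb_shift_diff[of i b' a] gb_shift_nonneg[of "a - 1" b' i] Suc Suc.prems Q1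
      by (smt (verit, best) Suc_leD add_Suc_right add_Suc_shift mult_nonneg_nonneg zero_le_power)
    thus ?thesis using Suc.IH Suc.prems by simp
  qed
qed simp

definition A1 :: real where
  "A1 = B 0 - real q ^ ((k - t) * (k + 1 - t)) * gb q (n - k - 1) (k - t)"

lemma A1_eq_sum: "A1 = (\<Sum>i<Suc (k - t). real q ^ i * gb_shift (n - t - 1) (k - t - 1) i)"
proof -
  have "gb_shift (n - t) (k - t) 0 - gb_shift (n - t) (k - t) j = (\<Sum>i<j. real q ^ i * gb_shift (n - t - 1) (k - t - 1) i)"
    if "j \<le> Suc (k - t)" for j
    using that
  proof (induction j)
    case (Suc j)
    have "gb_shift (n - t) (k - t) j - gb_shift (n - t) (k - t) (Suc j) = real q ^ j * gb_shift (n - t - 1) (k - t - 1) j"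
      using Suc.prems k_ge n_large by (intro gb_shift_diff') auto
    thus ?case using Suc by simp
  qed simp
  from this[OF order_refl]
  have "gb_shift (n - t) (k - t) 0 - gb_shift (n - t) (k - t) (Suc (k - t))
      = (\<Sum>i<Suc (k - t). real q ^ i * gb_shift (n - t - 1) (k - t - 1) i)" .
  moreover have "gb_shift (n - t) (k - t) 0 = B 0" by (simp add: gb_shift_0 B_def)
  moreover have "Suc (k - t) = k + 1 - t" "n - t - Suc (k - t) = n - k - 1" using k_ge by auto
  hence "gb_shift (n - t) (k - t) (Suc (k - t)) = real q ^ ((k - t) * (k + 1 - t)) * gb q (n - k - 1) (k - t)"
    unfolding gb_shift_def by metis
  ultimately show ?thesis unfolding A1_def by linarith
qed

lemma gb_shift_step_0: "gb_shift (n - t - 1) (k - t - 1) 0 = B 1"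
  by (simp add: gb_shift_0 B_def)

lemma gb_shift_step:
  assumes "i \<le> k - t"
  shows "B 1 - qint q i * B 2 \<le> gb_shift (n - t - 1) (k - t - 1) i"
  using assms
proof (induction i)
  case (Suc i)
  have "gb_shift (n - t - 2) (k - t - 2) i \<le> gb_shift (n - t - 2) (k - t - 2) 0"
    using Suc.prems k_ge n_large by (intro gb_shift_antimono) auto
  also have "\<dots> = B 2" by (simp add: gb_shift_0 B_def)
  finally have "real q ^ i * gb_shift (n - t - 2) (k - t - 2) i \<le> real q ^ i * B 2"
    using Q1 by (intro mult_left_mono) auto
  moreover have "gb_shift (n - t - 1) (k - t - 1) i - gb_shift (n - t - 1) (k - t - 1) (Suc i)
      = real q ^ i * gb_shift (n - t - 2) (k - t - 2) i"
    using gb_shift_diff'[of "k - t - 1" i "n - t - 1"] Suc.prems k_ge n_large by (simp add: numeral_2_eq_2)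
  moreover have "qint q (Suc i) * B 2 = real q ^ i * B 2 + qint q i * B 2"
    by (simp add: qint_Suc'[OF real_q_gt_1] distrib_right)
  ultimately show ?case using Suc by linarith
qed (use gb_shift_step_0 in \<open>simp add: qint_def\<close>)

lemma sum_powers: "(\<Sum>i<j. real q ^ i) = qint q j"
  by (induction j) (simp_all add: qint_def[of _ 0] qint_Suc'[OF real_q_gt_1])

lemma c_eq_sum: "c = (\<Sum>i<Suc (k - t). real q ^ i)"
  by (simp only: sum_powers) simp

text \<open>The weights \<open>q ^ i\<close> in \<open>A1_eq_sum\<close> add up to \<open>c\<close>,
  and each weighted term differs from \<open>B 1\<close> by at most
  \<open>qint q (k - t) * B 2\<close>.\<close>

lemma A1_lower: "c * (B 1 - qint q (k - t) * B 2) \<le> A1"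
proof -
  have "c * (B 1 - qint q (k - t) * B 2) = (\<Sum>i<Suc (k - t). real q ^ i * (B 1 - qint q (k - t) * B 2))"
    by (simp only: c_eq_sum sum_distrib_right)
  also have "\<dots> \<le> A1" unfolding A1_eq_sum
  proof (intro sum_mono mult_left_mono)
    fix i assume "i \<in> {..<Suc (k - t)}"
    hence i: "i \<le> k - t" by auto
    have "qint q i * B 2 \<le> qint q (k - t) * B 2"
      using i B_nonneg by (intro mult_right_mono qint_mono real_q_gt_1)
    thus "B 1 - qint q (k - t) * B 2 \<le> gb_shift (n - t - 1) (k - t - 1) i" using gb_shift_step[OF i] by linarith
  qed (use Q1 in auto)
  finally show ?thesis .
qed

lemma A1_upper: "A1 \<le> c * B 1"
proof -
  have "A1 \<le> (\<Sum>i<Suc (k - t). real q ^ i * B 1)" unfolding A1_eq_sum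
  proof (intro sum_mono mult_left_mono)
    fix i assume i: "i \<in> {..<Suc (k - t)}"
    show "gb_shift (n - t - 1) (k - t - 1) i \<le> B 1"
      unfolding gb_shift_step_0[symmetric] using i n_large by (intro gb_shift_antimono) auto
  qed (use Q1 in auto)
  also have "\<dots> = c * B 1" by (simp only: c_eq_sum sum_distrib_right)
  finally show ?thesis .
qed

text \<open>The terms with indices 0 and 1 are kept exactly and the rest is replaced by the term
  with index 2. For \<open>k = 2 * t\<close> this makes the total loss almost
  \<open>2 * (c - 1) * B 2\<close> or more; stopping at index 1 would give only
  \<open>(c - 1) * B 2\<close>, too little against the factor \<open>4 / 3\<close> in
  \<open>B1_square_le\<close>.\<close>

lemma A1_upper_second_order:
  assumes "t + 3 \<le> k"
  shows "A1 \<le> c * B 1 - (c - 1) * B 2 - (c - 1 - q) * (q * (B 2 - B 3))"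
proof -
  obtain m where "k = t + 3 + m" using le_Suc_ex[OF assms] by blast
  hence m: "k - t = Suc (Suc (Suc m))" by simp
  let ?D = "gb_shift (n - t - 1) (k - t - 1)"
  have diff: "?D i - ?D (Suc i) = real q ^ i * gb_shift (n - t - 2) (k - t - 2) i" if "i \<le> k - t" for i
    using gb_shift_diff'[of "k - t - 1" i "n - t - 1"] that n_large assms by (simp add: numeral_2_eq_2)
  have P2: "gb_shift (n - t - 2) (k - t - 2) 0 = B 2" by (simp add: gb_shift_0 B_def)
  have D1: "?D 1 = B 1 - B 2"
    using diff[of 0] gb_shift_step_0 P2 by (simp only: One_nat_def power_0) linarith
  have "gb_shift (n - t - 2) (k - t - 2) 0 - gb_shift (n - t - 2) (k - t - 2) (Suc 0)
      = real q ^ 0 * gb_shift (n - t - 2 - 1) (k - t - 2 - 1) 0"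
    using n_large assms by (intro gb_shift_diff') auto
  moreover have "gb_shift (n - t - 2 - 1) (k - t - 2 - 1) 0 = B 3" by (simp add: gb_shift_0 B_def numeral_3_eq_3)
  ultimately have "gb_shift (n - t - 2) (k - t - 2) 1 = B 2 - B 3" using P2 by simp
  hence "?D 1 - ?D (Suc 1) = q * (B 2 - B 3)"
    using diff[of 1] assms by simp
  hence D2: "?D 2 = B 1 - B 2 - q * (B 2 - B 3)"
    using D1 by (simp only: Suc_1)
  have D: "?D (Suc (Suc i)) \<le> ?D 2" if "Suc (Suc i) \<le> k - t" for i
    using that
  proof (induction i)
    case (Suc i)
    have "?D (Suc (Suc i)) - ?D (Suc (Suc (Suc i))) = real q ^ Suc (Suc i) * gb_shift (n - t - 2) (k - t - 2) (Suc (Suc i))"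
      using Suc.prems by (intro diff) simp
    moreover have "0 \<le> real q ^ Suc (Suc i) * gb_shift (n - t - 2) (k - t - 2) (Suc (Suc i))"
      by (intro mult_nonneg_nonneg gb_shift_nonneg) auto
    ultimately show ?case using Suc by simp
  qed (simp add: numeral_2_eq_2)
  have "A1 = ?D 0 + q * ?D 1 + (\<Sum>i<Suc (Suc m). real q ^ Suc (Suc i) * ?D (Suc (Suc i)))"
    unfolding A1_eq_sum m by (simp only: sum.lessThan_Suc_shift[of _ "Suc (Suc (Suc m))"] sum.lessThan_Suc_shift[of _ "Suc (Suc m)"]) simp
  also have "\<dots> \<le> ?D 0 + q * ?D 1 + (\<Sum>i<Suc (Suc m). real q ^ Suc (Suc i) * ?D 2)"
    using D m Q1 by (intro add_left_mono sum_mono mult_left_mono) auto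
  also have "\<dots> = ?D 0 + q * ?D 1 + (\<Sum>i<Suc (Suc m). real q ^ Suc (Suc i)) * ?D 2"
    by (simp only: sum_distrib_right)
  also have "(\<Sum>i<Suc (Suc m). real q ^ Suc (Suc i)) = c - 1 - q"
    unfolding c_eq_sum unfolding m by (simp only: sum.lessThan_Suc_shift[of _ "Suc (Suc (Suc m))"] sum.lessThan_Suc_shift[of _ "Suc (Suc m)"]) simp
  also have "?D 0 + q * ?D 1 + (c - 1 - q) * ?D 2
      = c * B 1 - (c - 1) * B 2 - (c - 1 - q) * (q * (B 2 - B 3))"
    unfolding gb_shift_step_0 D1 D2 by (simp add: algebra_simps)
  finally show ?thesis .
qed

definition G1 :: real where
  "G1 = (A1 + real s) * (B 0 + min (real s) (real q ^ (k - t + 1) * qint q t))"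

text \<open>The value of \<open>g2\<close> regrouped as a product: \<open>B 0 - B 1\<close> counts
  the k-spaces meeting a fixed \<open>(t + 1)\<close>-space in a fixed t-space
  (\<open>B0_eq\<close>), so the second factor is the size of \<open>M_fam\<close>.\<close>

definition G2 :: real where
  "G2 = B 1 * (qint q (t + 1) * (B 0 - B 1) + B 1)"

text \<open>The constant \<open>3 / 4\<close> leaves room on both sides: \<open>G1\<close> and
  \<open>G2\<close> reach \<open>99 / 100\<close> of their leading terms, while the worst case to be
  discarded, \<open>spread\<close>, stays close to \<open>1 / 2\<close>.\<close>

definition small :: "'b set set \<Rightarrow> 'b set set \<Rightarrow> bool" where
  "small \<F> \<G> \<longleftrightarrow> real (card \<F>) * real (card \<G>) \<le> 3 / 4 * (main_coeff * (B 0 * B 1))"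

lemma c_le_main_coeff: "c \<le> main_coeff" and qint_le_main_coeff: "qint q (t + 1) \<le> main_coeff"
  by (auto simp: main_coeff_def)

lemma main_coeff_ge_1: "1 \<le> main_coeff"
  using c_ge_1 c_le_main_coeff by linarith

lemma smallI:
  assumes "real (card \<F>) \<le> x" "real (card \<G>) \<le> y" "x * y \<le> 3 / 4 * (main_coeff * (B 0 * B 1))"
  shows "small \<F> \<G>"
proof -
  have "real (card \<F>) * real (card \<G>) \<le> x * y" using assms by (intro mult_mono) linarith+
  thus ?thesis using assms(3) by (simp add: small_def)
qed

lemma BB_pos: "0 < B 0 * B 1"
  using B_pos by simp

lemma smallI_const:
  assumes "real (card \<F>) \<le> x" "real (card \<G>) \<le> y" "x * y \<le> 3 / 4 * (B 0 * B 1)"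
  shows "small \<F> \<G>"
proof (rule smallI[OF assms(1,2)])
  have "1 * (B 0 * B 1) \<le> main_coeff * (B 0 * B 1)" using main_coeff_ge_1 BB_pos by (intro mult_right_mono) auto
  thus "x * y \<le> 3 / 4 * (main_coeff * (B 0 * B 1))" using assms(3) by linarith
qed

lemma almost_cross_cases:
  assumes P: "almost_cross \<F> \<G>" and E: "subspace E" "dim E = t" "\<And>A. A \<in> \<F> \<Longrightarrow> E \<subseteq> A"
    and nonempty: "\<F> \<noteq> {}" and G_cov: "\<not> is_cover \<G> 0"
  obtains (small) "small \<F> \<G>"
  | (flag) L where "subspace L" "dim L = t + 1" "\<And>A. A \<in> \<F> \<Longrightarrow> L \<subseteq> A" "\<And>A. A \<in> \<G> \<Longrightarrow> t \<le> dim (A \<inter> L)"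
  | (star) X where "star_like \<F> \<G> X E"
proof -
  have card_G: "B 0 + qint q (t + 1) * (real s + c * B 1) \<le> 201 / 200 * B 0"
    using G_extra_small by linarith
  note facts = s_small cB2_small ccB2_small B_pos[of 0] B_pos[of 1]
  show ?thesis
  proof (rule cover_cases[OF P E nonempty G_cov])
    fix j assume level: "2 \<le> j" "t + j \<le> k" "real (card \<F>) \<le> \<phi> j"
      "real (card \<G>) \<le> 2 * (gb q (t + j) t * max (real s) (B 0))"
    have "B 1 \<le> B 0"
      using R_B1 mult_right_mono[OF one_le_power[OF Q1, of "n - k"] B_nonneg[of 1]] by linarith
    hence m: "max (real s) (B 0) = B 0" using facts by linarith
    have "\<phi> j * (2 * (gb q (t + j) t * B 0)) = 2 * ((gb q (t + j) t * \<phi> j) * B 0)" by simp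
    also have "\<dots> \<le> 2 * (B 1 / 10 * B 0)"
      using level_bound_2[OF level(1,2)] B_nonneg[of 0] by (intro mult_left_mono mult_right_mono) auto
    also have "\<dots> \<le> 3 / 4 * (B 0 * B 1)" using BB_pos by simp
    finally show ?thesis using level(4) unfolding m by (intro that(1) smallI_const[OF level(3)])
  next
    assume common: "real (card \<F>) \<le> real s + c * B 2" "real (card \<G>) \<le> qint q (t + 1) * B 0"
    have "(real s + c * B 2) * (qint q (t + 1) * B 0) \<le> (B 1 / 2) * (main_coeff * B 0)"
      using facts qint_le_main_coeff c_nonneg B_nonneg main_coeff_ge_1 qint_nonneg[OF real_q_gt_1, of "t + 1"]
      by (intro mult_mono) auto
    also have "\<dots> \<le> 3 / 4 * (main_coeff * (B 0 * B 1))" using mult_nonneg_nonneg[of main_coeff "B 0 * B 1"] main_coeff_ge_1 BB_pos by simp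
    finally show ?thesis by (intro that(1) smallI[OF common])
  next
    assume far: "real (card \<F>) \<le> real s + c * (c * B 2)"
      "real (card \<G>) \<le> B 0 + qint q (t + 1) * (real s + c * B 1)"
    have "(real s + c * (c * B 2)) * (B 0 + qint q (t + 1) * (real s + c * B 1)) \<le> (B 1 / 2) * (201 / 200 * B 0)"
      using facts card_G c_nonneg B_nonneg qint_nonneg[OF real_q_gt_1, of "t + 1"]
      by (intro mult_mono) (auto intro!: add_nonneg_nonneg mult_nonneg_nonneg)
    also have "\<dots> \<le> 3 / 4 * (B 0 * B 1)" using BB_pos by simp
    finally show ?thesis by (intro that(1) smallI_const[OF far])
  next
    assume spread: "real (card \<F>) \<le> 2 * real s + qint q (k - t) * B 1 + c * (c * B 2)"
      "real (card \<G>) \<le> B 0 + qint q (t + 1) * (real s + c * B 1)"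
    let ?x = "qint q (k - t)"
    have x: "0 \<le> ?x" by (rule qint_nonneg[OF real_q_gt_1])
    \<comment> \<open>The decisive gain in this case: lowering the dimension from
      \<open>k - t + 1\<close> to \<open>k - t\<close> more than halves the number of
      points.\<close>
    have "2 * ?x + 1 \<le> real q * ?x + 1" using x real_q_ge_2 by (intro add_right_mono mult_right_mono) auto
    also have "\<dots> = c" using qint_Suc[OF real_q_gt_1, of "k - t"] by simp
    finally have cx: "2 * ?x + 1 \<le> main_coeff" using c_le_main_coeff by linarith
    have "(2 * real s + ?x * B 1 + c * (c * B 2)) * (B 0 + qint q (t + 1) * (real s + c * B 1))
        \<le> ((?x + 1 / 100) * B 1) * (201 / 200 * B 0)"
    proof (rule mult_mono[OF _ card_G])
      show "2 * real s + ?x * B 1 + c * (c * B 2) \<le> (?x + 1 / 100) * B 1"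
        using facts unfolding distrib_right by linarith
      show "0 \<le> (?x + 1 / 100) * B 1" using x B_nonneg by simp
      show "0 \<le> B 0 + qint q (t + 1) * (real s + c * B 1)"
        using B_nonneg c_nonneg qint_nonneg[OF real_q_gt_1, of "t + 1"] by (auto intro!: add_nonneg_nonneg mult_nonneg_nonneg)
    qed
    also have "\<dots> = (201 / 200 * (?x + 1 / 100)) * (B 0 * B 1)" by simp
    also have "\<dots> \<le> (3 / 4 * main_coeff) * (B 0 * B 1)"
      using cx x BB_pos by (intro mult_right_mono) auto
    finally show ?thesis by (intro that(1) smallI[OF spread]) (simp only: mult.assoc)
  next
    fix L assume "subspace L" "dim L = t + 1" "\<And>A. A \<in> \<F> \<Longrightarrow> L \<subseteq> A"
      "\<And>A. A \<in> \<G> \<Longrightarrow> t \<le> dim (A \<inter> L)"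
    thus ?thesis by (rule that(2))
  next
    fix X assume "star_like \<F> \<G> X E"
    thus ?thesis by (rule that(3))
  qed
qed

text \<open>The bound for \<open>\<F>\<close> combines its own cover level \<open>i\<close> with
  \<open>\<phi> j\<close>, that for \<open>\<G>\<close> combines \<open>j\<close> with
  \<open>\<phi> i\<close>. Exchanging the two \<open>\<phi>\<close> factors in the product leaves
  two expressions in one level each, to which \<open>level_bound_1\<close> applies.\<close>

lemma both_uncovered_small:
  assumes P: "almost_cross \<F> \<G>" and "\<F> \<noteq> {}" "\<G> \<noteq> {}" "\<not> is_cover \<F> 0" "\<not> is_cover \<G> 0"
  shows "small \<F> \<G>"
proof -
  obtain i where i: "1 \<le> i" "t + i \<le> k" "is_cover \<F> i \<or> i = k - t"
    "\<And>T. subspace T \<Longrightarrow> dim T < t + i \<Longrightarrow> \<exists>G\<in>\<F>. dim (T \<inter> G) < t"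
    by (rule obtain_level[OF assms(2,4)]) blast
  obtain j where j: "1 \<le> j" "t + j \<le> k" "is_cover \<G> j \<or> j = k - t"
    "\<And>T. subspace T \<Longrightarrow> dim T < t + j \<Longrightarrow> \<exists>G\<in>\<G>. dim (T \<inter> G) < t"
    by (rule obtain_level[OF assms(3,5)]) blast
  have s\<phi>: "real s \<le> \<phi> l" if "1 \<le> l" for l
  proof -
    have "(\<Sum>i\<in>{0}. c ^ i) \<le> (\<Sum>i<l. c ^ i)" using that c_nonneg by (intro sum_mono2) auto
    hence "real s * 1 \<le> real s * (\<Sum>i<l. c ^ i)" by (intro mult_left_mono) auto
    moreover have "0 \<le> c ^ l * B l" using c_nonneg B_nonneg by simp
    ultimately show ?thesis unfolding \<phi>_def by linarith
  qed
  have F: "real (card \<F>) \<le> 2 * (gb q (t + i) t * \<phi> j)"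
    by (rule card_le_level[OF almost_cross_sym[OF P] assms(3) i(3,2) s\<phi>[OF j(1)]])
       (use card_above_\<phi>[OF P j(2) _ _ j(4)] in blast)
  have G: "real (card \<G>) \<le> 2 * (gb q (t + j) t * \<phi> i)"
    by (rule card_le_level[OF P assms(2) j(3,2) s\<phi>[OF i(1)]])
       (use card_above_\<phi>[OF almost_cross_sym[OF P] i(2) _ _ i(4)] in blast)
  let ?b = "101 / 100 * (real q ^ (t + k + 1) * B 1)"
  have "(2 * (gb q (t + i) t * \<phi> j)) * (2 * (gb q (t + j) t * \<phi> i))
      = 4 * ((gb q (t + i) t * \<phi> i) * (gb q (t + j) t * \<phi> j))" by simp
  also have "\<dots> \<le> 4 * (?b * ?b)"
    using gb_nonneg[OF real_q_gt_1] \<phi>_nonneg B_nonneg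
    by (intro mult_left_mono[OF mult_mono[OF level_bound_1[OF i(1,2)] level_bound_1[OF j(1,2)]]]) simp_all
  also have "\<dots> \<le> 5 * (real q ^ (2 * (t + k + 1)) * (B 1 * B 1))"
  proof -
    have "0 \<le> real q ^ (t + k + 1) * real q ^ (t + k + 1) * (B 1 * B 1)" using Q1 B_nonneg by simp
    thus ?thesis unfolding mult_2 power_add[of _ "t + k + 1" "t + k + 1"] by simp
  qed
  also have "\<dots> \<le> 3 / 4 * (B 0 * B 1)"
  proof -
    have "13 * 2 ^ 0 * real q ^ (2 * (t + k + 1)) \<le> R" using t_pos by (intro R_ge_power) simp
    hence "13 * (real q ^ (2 * (t + k + 1)) * B 1) \<le> B 0"
      using mult_B_le[OF _ R_B1 B_nonneg, of 13] by simp
    hence "13 * (real q ^ (2 * (t + k + 1)) * B 1) * B 1 \<le> B 0 * B 1"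
      using B_nonneg by (intro mult_right_mono)
    thus ?thesis using BB_pos by (simp add: mult.assoc)
  qed
  finally show ?thesis by (rule smallI_const[OF F G])
qed

text \<open>Each common t-space is missed by a member of the other family, so both families have
  size at most \<open>s + c * B 1\<close>; the product is of order \<open>(c * B 1) ^ 2\<close>, and
  one factor \<open>B 1\<close> is negligible against \<open>B 0\<close>.\<close>

lemma both_covered_small:
  assumes P: "almost_cross \<F> \<G>" and E: "subspace E" "dim E = t" "\<And>A. A \<in> \<F> \<Longrightarrow> E \<subseteq> A" "\<exists>A\<in>\<G>. \<not> E \<subseteq> A"
    and E': "subspace E'" "dim E' = t" "\<And>A. A \<in> \<G> \<Longrightarrow> E' \<subseteq> A" "\<exists>A\<in>\<F>. \<not> E' \<subseteq> A"
  shows "small \<F> \<G>"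
proof -
  have above: "above \<F> E = \<F>" "above \<G> E' = \<G>" using E(3) E'(3) by (auto simp: above_def)
  obtain X where X: "X \<in> \<G>" "\<not> E \<subseteq> X" using E(4) by blast
  obtain Y where Y: "Y \<in> \<F>" "\<not> E' \<subseteq> Y" using E'(4) by blast
  have F: "real (card \<F>) \<le> real s + c * B 1"
    using card_above_t[OF P X(1) E(1,2) X(2)] by (simp only: above)
  have G: "real (card \<G>) \<le> real s + c * B 1"
    using card_above_t[OF almost_cross_sym[OF P] Y(1) E'(1,2) Y(2)] by (simp only: above)
  let ?x = "2 * (real q ^ (k - t + 1) * B 1)"
  have x: "real s + c * B 1 \<le> ?x"
  proof -
    have "real s \<le> real q ^ (k - t + 1) * B 1"
      using s_small mult_right_mono[OF one_le_power[OF Q1, of "k - t + 1"] B_nonneg[of 1]] by linarith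
    thus ?thesis using mult_right_mono[OF c_le B_nonneg[of 1]] by linarith
  qed
  have "?x * ?x = 4 * (real q ^ (2 * (k - t + 1)) * B 1) * B 1"
    unfolding mult_2[of "k - t + 1"] power_add[of _ "k - t + 1" "k - t + 1"] by simp
  also have "\<dots> \<le> 3 / 4 * (B 0 * B 1)"
  proof -
    have "13 * 2 ^ 0 * real q ^ (2 * (k - t + 1)) \<le> R" using t_pos by (intro R_ge_power) simp
    hence "13 * (real q ^ (2 * (k - t + 1)) * B 1) \<le> B 0"
      using mult_B_le[OF _ R_B1 B_nonneg, of 13] by simp
    hence "13 * (real q ^ (2 * (k - t + 1)) * B 1) * B 1 \<le> B 0 * B 1"
      using B_nonneg by (intro mult_right_mono)
    thus ?thesis using BB_pos by (simp add: mult.assoc)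
  qed
  finally show ?thesis by (rule smallI_const[OF order_trans[OF F x] order_trans[OF G x]])
qed

section \<open>The extremal products against the discarded cases\<close>

lemma B1_small: "1000 * B 1 \<le> B 0"
proof -
  have "13 * 2 ^ 7 * real q ^ 0 \<le> R" using k_ge t_pos by (intro R_ge_power) simp
  hence "1000 \<le> R" by simp
  hence "1000 * B 1 \<le> R * B 1" using B_nonneg by (intro mult_right_mono)
  thus ?thesis using R_B1 by linarith
qed

lemma cB1_small: "1000 * (c * B 1) \<le> B 0"
proof -
  have "13 * 2 ^ 7 * real q ^ (k - t + 1) \<le> R" using k_ge t_pos by (intro R_ge_power) simp
  moreover have "1000 * c \<le> 13 * 2 ^ 7 * real q ^ (k - t + 1)" using c_le c_nonneg by simp
  ultimately show ?thesis using B_nonneg by (intro mult_B_le[OF _ R_B1]) auto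
qed

lemma G2_le: "G2 \<le> qint q (t + 1) * (B 0 * B 1)"
proof -
  have "1 \<le> qint q (t + 1)" using power_le_qint_Suc[OF real_q_gt_1, of t] one_le_power[OF Q1, of t] by simp
  hence "1 * B 1 \<le> qint q (t + 1) * B 1" using B_nonneg by (intro mult_right_mono)
  hence "qint q (t + 1) * (B 0 - B 1) + B 1 \<le> qint q (t + 1) * B 0" by (simp add: right_diff_distrib)
  hence "G2 \<le> B 1 * (qint q (t + 1) * B 0)" unfolding G2_def using B_nonneg by (intro mult_left_mono)
  thus ?thesis by (simp add: mult_ac)
qed

lemma G2_ge: "99 / 100 * (qint q (t + 1) * (B 0 * B 1)) \<le> G2"
proof -
  have "99 / 100 * B 0 \<le> B 0 - B 1" using B1_small B_pos[of 0] by linarith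
  hence "qint q (t + 1) * (99 / 100 * B 0) \<le> qint q (t + 1) * (B 0 - B 1)"
    by (intro mult_left_mono qint_nonneg[OF real_q_gt_1])
  hence "qint q (t + 1) * (99 / 100 * B 0) \<le> qint q (t + 1) * (B 0 - B 1) + B 1"
    using B_nonneg[of 1] by linarith
  hence "B 1 * (qint q (t + 1) * (99 / 100 * B 0)) \<le> G2"
    unfolding G2_def using B_nonneg by (intro mult_left_mono)
  thus ?thesis by (simp add: mult_ac)
qed

lemma A1_nonneg: "0 \<le> A1"
  unfolding A1_eq_sum using gb_shift_nonneg by (intro sum_nonneg mult_nonneg_nonneg) auto

lemma min_nonneg: "0 \<le> min (real s) (real q ^ (k - t + 1) * qint q t)"
  using qint_nonneg[OF real_q_gt_1, of t] by simp

lemma G1_ge: "99 / 100 * (c * (B 0 * B 1)) \<le> G1"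
proof -
  have "qint q (k - t) * B 2 \<le> c * B 2"
    using B_nonneg by (intro mult_right_mono qint_mono real_q_gt_1) auto
  hence "99 / 100 * B 1 \<le> B 1 - qint q (k - t) * B 2" using cB2_small B_pos[of 1] by linarith
  hence "c * (99 / 100 * B 1) \<le> c * (B 1 - qint q (k - t) * B 2)" by (rule mult_left_mono[OF _ c_nonneg])
  hence "c * (99 / 100 * B 1) \<le> A1 + real s" using A1_lower by linarith
  hence "(c * (99 / 100 * B 1)) * B 0 \<le> G1"
    unfolding G1_def using A1_nonneg B_nonneg min_nonneg by (intro mult_mono) auto
  thus ?thesis by (simp add: mult_ac)
qed

lemma G1_le: "G1 \<le> (A1 + real s) * (B 0 + real s)"
  unfolding G1_def using A1_nonneg by (intro mult_left_mono) auto

lemma small_less_G2: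
  assumes "k \<le> 2 * t" "small \<F> \<G>" shows "real (card \<F>) * real (card \<G>) < G2"
proof -
  have "c \<le> qint q (t + 1)" using assms(1) by (intro qint_mono real_q_gt_1) auto
  hence coeff: "main_coeff = qint q (t + 1)" by (simp add: main_coeff_def)
  have "0 < main_coeff * (B 0 * B 1)" using main_coeff_ge_1 BB_pos by simp
  thus ?thesis using G2_ge assms(2) unfolding small_def coeff by linarith
qed

lemma small_less_G1:
  assumes "2 * t + 1 \<le> k" "small \<F> \<G>" shows "real (card \<F>) * real (card \<G>) < G1"
proof -
  have "qint q (t + 1) \<le> c" using assms(1) by (intro qint_mono real_q_gt_1) auto
  hence coeff: "main_coeff = c" by (simp add: main_coeff_def)
  have "0 < main_coeff * (B 0 * B 1)" using main_coeff_ge_1 BB_pos by simp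
  thus ?thesis using G1_ge assms(2) unfolding small_def coeff by linarith
qed

lemma qint_step: "2 * qint q i + 1 \<le> qint q (Suc i)"
  unfolding qint_Suc[OF real_q_gt_1] using real_q_ge_2 qint_nonneg[OF real_q_gt_1]
  by (intro add_right_mono mult_right_mono) auto

text \<open>The point counts behind the two leading coefficients belong to dimensions differing by
  at least one, hence differ by a factor of at least 2, far more than the errors of
  \<open>1 / 100\<close>.\<close>

lemma G2_less_G1:
  assumes "2 * t + 1 \<le> k" shows "G2 < G1"
proof -
  have "2 * qint q (t + 1) + 1 \<le> qint q (Suc (t + 1))" by (rule qint_step)
  also have "\<dots> \<le> c" using assms by (intro qint_mono real_q_gt_1) auto
  finally have "2 * qint q (t + 1) * (B 0 * B 1) \<le> c * (B 0 * B 1)"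
    using BB_pos by (intro mult_right_mono) auto
  moreover have "0 < c * (B 0 * B 1)" using c_ge_1 BB_pos by simp
  ultimately show ?thesis using G2_le G1_ge by linarith
qed

lemma G1_less_G2_of_less:
  assumes "k < 2 * t" shows "G1 < G2"
proof -
  have "2 * c + 1 \<le> qint q (Suc (k - t + 1))" by (rule qint_step)
  also have "\<dots> \<le> qint q (t + 1)" using assms by (intro qint_mono real_q_gt_1) auto
  finally have 1: "2 * c + 1 \<le> qint q (t + 1)" .
  have "(A1 + real s) * (B 0 + real s) \<le> ((c + 1 / 1000) * B 1) * (1001 / 1000 * B 0)"
    using A1_upper s_small A1_nonneg B1_small B_pos[of 0] c_nonneg B_nonneg[of 1]
    by (intro mult_mono) (auto simp: distrib_right)
  also have "\<dots> = (1001 / 1000 * (c + 1 / 1000)) * (B 0 * B 1)" by simp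
  also have "\<dots> < (99 / 100 * qint q (t + 1)) * (B 0 * B 1)"
    using 1 c_nonneg BB_pos by (intro mult_strict_right_mono) auto
  also have "\<dots> \<le> G2" using G2_ge by simp
  finally show ?thesis using G1_le by linarith
qed

section \<open>Comparison of the two extremal products\<close>

text \<open>With \<open>X\<close> and \<open>u\<close> as in the proof, the exact ratios
  \<open>B 0 / B 1 = (q * X - 1) / (q * u - 1)\<close> and
  \<open>B 1 / B 2 = (X - 1) / (u - 1)\<close> bound the quotient of \<open>B 1 * B 1\<close> by
  \<open>B 0 * B 2\<close> by \<open>u / (u - 1)\<close>. For \<open>t \<ge> 3\<close> one has
  \<open>u \<ge> 4\<close>, whence \<open>4 / 3\<close>.\<close>

lemma B1_square_le:
  assumes "k = 2 * t" "3 \<le> t" shows "3 * (B 1 * B 1) \<le> 4 * (B 0 * B 2)"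
proof -
  define X u where "X = real q ^ (n - t - 1)" and "u = real q ^ (t - 1)"
  let ?Q = "real q"
  have n2: "Suc (t - 2) = t - 1" "Suc (n - t - 2) = n - t - 1" using assms n_large by auto
  have pw: "?Q ^ Suc (t - 1) = ?Q * u" "?Q ^ Suc (n - t - 1) = ?Q * X" "?Q ^ Suc (t - 2) = u"
    "?Q ^ Suc (n - t - 2) = X"
    unfolding n2 by (simp_all add: X_def u_def)
  have u4: "4 \<le> u"
  proof -
    have "(2::real) ^ 2 \<le> 2 ^ (t - 1)" using assms(2) by (intro power_increasing) auto
    also have "\<dots> \<le> u" unfolding u_def using real_q_ge_2 by (intro power_mono) auto
    finally show ?thesis by simp
  qed
  have X1: "1 < X" unfolding X_def using real_q_gt_1 n_large by (intro one_less_power) auto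
  have "B 0 = B 1 * ((?Q ^ Suc (n - t - 1) - 1) / (?Q ^ Suc (t - 1) - 1))"
  proof -
    have "n - (t + 0) = Suc (n - t - 1)" "k - (t + 0) = Suc (t - 1)" using assms n_large by auto
    hence "B 0 = gb q (Suc (n - t - 1)) (Suc (t - 1))" unfolding B_def by (simp only:)
    moreover have "n - (t + 1) = n - t - 1" "k - (t + 1) = t - 1" using assms by auto
    hence "B 1 = gb q (n - t - 1) (t - 1)" unfolding B_def by (simp only:)
    ultimately show ?thesis by (simp only: gb_Suc_Suc)
  qed
  hence 0: "B 0 * (?Q * u - 1) = B 1 * (?Q * X - 1)"
    unfolding pw using real_q_ge_2 u4 mult_mono[of 1 ?Q 4 u] by (simp add: field_simps)
  have "B 1 = B 2 * ((?Q ^ Suc (n - t - 2) - 1) / (?Q ^ Suc (t - 2) - 1))"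
  proof -
    have "Suc (n - t - 2) = n - (t + 1)" "Suc (t - 2) = k - (t + 1)" using assms n_large by auto
    moreover have "n - t - 2 = n - (t + 2)" "t - 2 = k - (t + 2)" using assms by auto
    ultimately show ?thesis using gb_Suc_Suc[of ?Q "n - t - 2" "t - 2"] unfolding B_def by simp
  qed
  hence 1: "B 1 * (u - 1) = B 2 * (X - 1)"
    unfolding pw using u4 by (simp add: field_simps)
  have "3 * (B 1 * B 1) * ((u - 1) * (?Q * X - 1)) = 3 * ((B 1 * (u - 1)) * (B 1 * (?Q * X - 1)))"
    by (simp only: mult_ac)
  also have "\<dots> = (B 0 * B 2) * ((3 * (?Q * u - 1)) * (X - 1))"
    unfolding 0[symmetric] 1 by (simp only: mult_ac)
  also have "\<dots> \<le> (B 0 * B 2) * ((4 * (u - 1)) * (?Q * X - 1))"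
  proof (intro mult_left_mono)
    have "?Q * 4 \<le> ?Q * u" using u4 by (intro mult_left_mono) auto
    hence "3 * (?Q * u - 1) \<le> 4 * (u - 1) * ?Q" by (simp add: algebra_simps)
    hence "(3 * (?Q * u - 1)) * (X - 1) \<le> (4 * (u - 1) * ?Q) * (X - 1)"
      using X1 by (intro mult_right_mono) auto
    also have "\<dots> = 4 * (u - 1) * (?Q * X - ?Q)" by (simp add: algebra_simps)
    also have "\<dots> \<le> 4 * (u - 1) * (?Q * X - 1)" using u4 Q1 by (intro mult_left_mono) auto
    finally show "(3 * (?Q * u - 1)) * (X - 1) \<le> (4 * (u - 1)) * (?Q * X - 1)" .
  qed (use B_nonneg in simp)
  also have "\<dots> = 4 * (B 0 * B 2) * ((u - 1) * (?Q * X - 1))" by (simp only: mult_ac)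
  finally have *: "3 * (B 1 * B 1) * ((u - 1) * (?Q * X - 1)) \<le> 4 * (B 0 * B 2) * ((u - 1) * (?Q * X - 1))" .
  have "1 < ?Q * X" using real_q_gt_1 X1 by (simp add: less_1_mult)
  hence "0 < (u - 1) * (?Q * X - 1)" using u4 by simp
  thus ?thesis by (rule mult_right_le_imp_le[OF *])
qed

text \<open>Both products start with \<open>c * (B 0 * B 1)\<close>. In units of
  \<open>B 0 * B 2\<close>, \<open>G1\<close> loses at least \<open>199 / 100 * d\<close> and
  regains at most 2 through \<open>s\<close>, while \<open>G2\<close> loses at most
  \<open>4 / 3 * d\<close>; \<open>d \<ge> 14\<close> settles the comparison.\<close>

lemma G1_less_G2_of_eq:
  assumes "k = 2 * t" "3 \<le> t" shows "G1 < G2"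
proof -
  let ?Q = "real q"
  define x d e where "x = qint q t" and "d = c - 1" and "e = (c - 1 - ?Q) * ?Q"
  have kt: "k - t = t" "k - t + 1 = Suc t" using assms(1) by auto
  have c: "c = ?Q * x + 1" using qint_Suc[OF real_q_gt_1, of t] unfolding kt x_def by simp
  have x: "7 \<le> x" "?Q \<le> x"
  proof -
    have "qint q 3 \<le> x" unfolding x_def using assms(2) by (intro qint_mono real_q_gt_1)
    moreover have "qint q 3 = ?Q * ?Q + ?Q + 1"
      by (simp only: numeral_3_eq_3 qint_Suc[OF real_q_gt_1]) (simp add: qint_def distrib_left)
    moreover have "4 \<le> ?Q * ?Q" using mult_mono[of 2 ?Q 2 ?Q] real_q_ge_2 by simp
    ultimately show "7 \<le> x" "?Q \<le> x" using real_q_ge_2 by linarith+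
  qed
  have d: "d = ?Q * x" unfolding d_def c by simp
  have d14: "14 \<le> d" unfolding d using mult_mono[of 2 ?Q 7 x] x real_q_ge_2 by simp
  have de: "d \<le> e"
  proof -
    have "2 * x \<le> ?Q * x" using x real_q_ge_2 by (intro mult_right_mono) auto
    hence "x \<le> ?Q * x - ?Q" using x by linarith
    hence "?Q * x \<le> ?Q * (?Q * x - ?Q)" by (intro mult_left_mono) auto
    thus ?thesis unfolding e_def c d by (simp add: mult.commute)
  qed
  have R100: "13 * 2 ^ 4 * real s * ?Q ^ 0 \<le> R" using k_ge t_pos by (intro R_ge_s_power) simp
  have "R * B 3 \<le> B 2" using B_ratio[of 2] assms by (simp add: numeral_3_eq_3 numeral_2_eq_2)
  moreover have "100 * B 3 \<le> R * B 3" using R100 s_ge_1 B_nonneg by (intro mult_right_mono) auto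
  ultimately have B3: "99 / 100 * B 2 \<le> B 2 - B 3" by linarith
  \<comment> \<open>Here \<open>t \<ge> 3\<close> enters: \<open>k - t - 2\<close> is at least 1, so
    \<open>B 2\<close> is at least \<open>R\<close> and dominates \<open>s\<close>.\<close>
  have sB2: "real s \<le> B 2"
  proof -
    have "R ^ 1 \<le> R ^ (k - t - 2)" using assms Q1 by (intro power_increasing one_le_power) auto
    hence "R \<le> B 2" using B_ge_power[of 2] assms by simp
    thus ?thesis using R100 by simp
  qed
  have pos: "0 < B 0 * B 2" using B_pos by simp
  have "d * (99 / 100 * B 2) \<le> e * (B 2 - B 3)" using de B3 d14 B_nonneg by (intro mult_mono) auto
  moreover have "t + 3 \<le> k" using assms by simp
  hence "A1 \<le> c * B 1 - d * B 2 - e * (B 2 - B 3)"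
    using A1_upper_second_order unfolding d_def e_def by (simp only: mult.assoc)
  ultimately have "A1 \<le> c * B 1 - d * B 2 - d * (99 / 100 * B 2)" by linarith
  hence "A1 * B 0 \<le> (c * B 1 - d * B 2 - d * (99 / 100 * B 2)) * B 0"
    using B_nonneg by (intro mult_right_mono)
  hence 1: "A1 * B 0 \<le> c * (B 0 * B 1) - 199 / 100 * (d * (B 0 * B 2))" by (simp add: algebra_simps)
  have 2: "real s * B 0 \<le> B 0 * B 2" using mult_right_mono[OF sB2 B_nonneg[of 0]] by (simp add: mult.commute)
  have "A1 + real s \<le> B 0" using A1_upper cB1_small s_small B1_small B_pos[of 0] by linarith
  hence 3: "(A1 + real s) * real s \<le> B 0 * B 2" using sB2 B_nonneg A1_nonneg by (intro mult_mono) auto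
  have 4: "G2 = c * (B 0 * B 1) - d * (B 1 * B 1)"
    unfolding G2_def d_def kt by (simp add: algebra_simps)
  have "d * (3 * (B 1 * B 1)) \<le> d * (4 * (B 0 * B 2))"
    using B1_square_le[OF assms] d14 by (intro mult_left_mono) auto
  hence 5: "3 * (d * (B 1 * B 1)) \<le> 4 * (d * (B 0 * B 2))" by simp
  have 6: "14 * (B 0 * B 2) \<le> d * (B 0 * B 2)" using d14 pos by (intro mult_right_mono) auto
  have "(A1 + real s) * (B 0 + real s) = A1 * B 0 + real s * B 0 + (A1 + real s) * real s"
    by (simp add: algebra_simps)
  thus ?thesis using G1_le 1 2 3 4 5 6 pos by linarith
qed

lemma G1_less_G2:
  assumes "k \<le> 2 * t" "(k, t) \<noteq> (4, 2)" shows "G1 < G2"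
proof (cases "k = 2 * t")
  case True
  hence "3 \<le> t" using assms(2) k_ge t_pos by (cases "t = 2") auto
  thus ?thesis using G1_less_G2_of_eq True by blast
qed (use assms G1_less_G2_of_less in simp)

section \<open>Sizes of the extremal families and the cases of equality\<close>

lemma card_H1:
  assumes "subspace S" "dim S = t + i" "t + i \<le> k"
  shows "real (card (H1 scale UNIV S k)) = B i"
  using card_subspaces_above[OF assms(1) subspace_UNIV subset_UNIV, of k] assms(2,3) dim_V
  by (simp add: H1_def B_def)

text \<open>Of the k-spaces through a t-space of a \<open>(t + 1)\<close>-space \<open>L\<close>,
  \<open>B 1\<close> contain \<open>L\<close>, and the remaining ones meet \<open>L\<close> exactly
  in the t-space.\<close>

lemma B0_eq: "B 0 = real q ^ (k - t) * gb q (n - t - 1) (k - t) + B 1"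
proof -
  have "Suc (n - t - 1) = n - t" "Suc (k - t - 1) = k - t" using k_ge n_large by auto
  thus ?thesis using gb_Pascal[OF real_q_gt_1, of "k - t - 1" "n - t - 1"] k_ge n_large
    by (simp add: B_def)
qed

lemma card_M_fam_le:
  assumes "subspace L" "dim L = t + 1"
  shows "real (card (M_fam scale L k t)) \<le> qint q (t + 1) * (B 0 - B 1) + B 1"
proof -
  let ?S = "subspaces_of_dim scale L t"
  have "M_fam scale L k t \<subseteq> H1 scale UNIV L k \<union> (\<Union>S\<in>?S. H2 scale L S k)"
  proof
    fix F assume "F \<in> M_fam scale L k t"
    hence F: "subspace F" "dim F = k" "t \<le> dim (F \<inter> L)" by (auto simp: M_fam_def)
    have FL: "subspace (F \<inter> L)" using F assms by (auto intro: subspace_inter)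
    show "F \<in> H1 scale UNIV L k \<union> (\<Union>S\<in>?S. H2 scale L S k)"
    proof (cases "dim (F \<inter> L) = t")
      case True
      thus ?thesis using F FL by (auto simp: H2_def)
    next
      case False
      hence "F \<inter> L = L" using subspace_dim_equal[OF FL assms(1)] F(3) assms(2) by auto
      thus ?thesis using F by (auto simp: H1_def)
    qed
  qed
  hence "card (M_fam scale L k t) \<le> card (H1 scale UNIV L k \<union> (\<Union>S\<in>?S. H2 scale L S k))"
    by (rule card_mono[OF finite_families])
  also have "\<dots> \<le> card (H1 scale UNIV L k) + card (\<Union>S\<in>?S. H2 scale L S k)" by (rule card_Un_le)
  finally have 1: "card (M_fam scale L k t) \<le> card (H1 scale UNIV L k) + card (\<Union>S\<in>?S. H2 scale L S k)" .
  have "real (card (\<Union>S\<in>?S. H2 scale L S k)) \<le> real (card ?S) * (B 0 - B 1)"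
  proof (rule card_le_sum_cover[OF _ subset_refl])
    fix S assume "S \<in> ?S"
    hence S: "subspace S" "S \<subseteq> L" "dim S = t" by auto
    have "real (card (H2 scale L S k)) = real q ^ (k - t) * gb q (n - t - 1) (k - t)"
      using card_H2[OF S(1) assms(1) S(2), of k] S(3) assms(2) k_ge dim_V by simp
    thus "real (card (H2 scale L S k)) \<le> B 0 - B 1" using B0_eq by simp
  qed (rule finite_families)
  moreover have "real (card ?S) = qint q (t + 1)"
    using card_subspaces_of_dim[OF assms(1), of t] assms(2) gb_t_Suc by simp
  moreover have "real (card (H1 scale UNIV L k)) = B 1" using card_H1[OF assms] k_ge by simp
  ultimately show ?thesis using 1 by simp
qed

lemma flag_bound:
  assumes P: "almost_cross \<F> \<G>" and L: "subspace L" "dim L = t + 1" "\<And>A. A \<in> \<F> \<Longrightarrow> L \<subseteq> A"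
    "\<And>A. A \<in> \<G> \<Longrightarrow> t \<le> dim (A \<inter> L)"
  shows "real (card \<F>) * real (card \<G>) \<le> G2"
    and "G2 \<le> real (card \<F>) * real (card \<G>) \<Longrightarrow>
      \<F> = H1 scale UNIV L k \<and> \<G> = M_fam scale L k t \<and> card \<F> < card \<G>"
proof -
  let ?m = "qint q (t + 1) * (B 0 - B 1) + B 1"
  have sub: "\<F> \<subseteq> H1 scale UNIV L k" "\<G> \<subseteq> M_fam scale L k t"
    using P L(3,4) by (auto simp: almost_cross_def H1_def M_fam_def)
  have cH: "real (card (H1 scale UNIV L k)) = B 1" using card_H1[OF L(1,2)] k_ge by simp
  have F: "real (card \<F>) \<le> B 1" using card_mono[OF finite_families sub(1)] cH by linarith
  have G: "real (card \<G>) \<le> ?m"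
    using card_mono[OF finite_families sub(2)] card_M_fam_le[OF L(1,2)] by linarith
  have m: "B 1 < ?m"
    using power_le_qint_Suc[OF real_q_gt_1, of t] one_le_power[OF Q1, of t] B1_small B_pos[of 0] B_pos[of 1]
    by simp
  show "real (card \<F>) * real (card \<G>) \<le> G2"
    unfolding G2_def using F G B_nonneg by (intro mult_mono) auto
  assume "G2 \<le> real (card \<F>) * real (card \<G>)"
  hence le: "B 1 * ?m \<le> real (card \<F>) * real (card \<G>)" unfolding G2_def .
  have m0: "0 < ?m" using m B_pos[of 1] by linarith
  have eq: "real (card \<F>) = B 1" "real (card \<G>) = ?m"
    by (rule mult_eq_imp_eq[OF of_nat_0_le_iff F of_nat_0_le_iff G B_pos m0 le])+
  have "\<F> = H1 scale UNIV L k" using sub(1) eq(1) cH by (intro card_subset_eq finite_families) auto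
  moreover have "\<G> = M_fam scale L k t"
    using sub(2) eq(2) card_M_fam_le[OF L(1,2)] by (intro card_seteq finite_families) auto
  moreover have "card \<F> < card \<G>" using eq m by linarith
  ultimately show "\<F> = H1 scale UNIV L k \<and> \<G> = M_fam scale L k t \<and> card \<F> < card \<G>" by blast
qed

definition star_extremal :: "'b set set \<Rightarrow> 'b set set \<Rightarrow> bool" where
  "star_extremal \<F> \<G> \<longleftrightarrow>
     (\<exists>X\<in>subspaces_of_dim scale UNIV (k + 1). \<exists>E\<in>subspaces_of_dim scale X t. \<exists>\<A> \<B>.
        \<F> = H1 scale UNIV E k - \<A> \<and> \<G> = H1 scale UNIV E k \<union> \<B> \<and>
        \<A> \<subseteq> H2 scale X E k \<and> \<B> \<subseteq> subspaces_of_dim scale X k - H1 scale X E k \<and>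
        real (card \<A>) = real q ^ ((k - t) * (k - t + 1)) * gb q (n - k - 1) (k - t) - real s \<and>
        real (card \<B>) = min (real s) (real q ^ (k - t + 1) * qint q t))"

text \<open>If no member of \<open>\<F>\<close> meets \<open>X\<close> exactly in \<open>E\<close>,
  the members of \<open>\<G>\<close> not through \<open>E\<close> are no longer limited by
  \<open>s\<close>. This inequality shows that their largest possible number still does not outweigh
  the loss of even one member of \<open>\<F>\<close>.\<close>

lemma A1_mult_less: "A1 * (real q ^ (k - t + 1) * qint q t) < B 0"
proof -
  have "real q ^ (k - t + 1) * qint q t \<le> real q ^ (k - t + 1) * real q ^ t"
    by (intro mult_left_mono qint_le_power[OF real_q_ge_2]) simp
  also have "\<dots> = real q ^ (k + 1)" using k_ge by (simp flip: power_add)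
  finally have "A1 * (real q ^ (k - t + 1) * qint q t) \<le> (c * B 1) * real q ^ (k + 1)"
    using A1_upper A1_nonneg c_nonneg B_nonneg qint_nonneg[OF real_q_gt_1] by (intro mult_mono) auto
  also have "\<dots> \<le> (real q ^ (k - t + 1) * B 1) * real q ^ (k + 1)"
    using c_le B_nonneg by (intro mult_right_mono) auto
  also have "\<dots> = real q ^ (k - t + 1 + (k + 1)) * B 1" by (simp only: power_add mult_ac)
  finally have 1: "A1 * (real q ^ (k - t + 1) * qint q t) \<le> real q ^ (k - t + 1 + (k + 1)) * B 1" .
  have "13 * 2 ^ 0 * real q ^ (k - t + 1 + (k + 1)) \<le> R" using t_pos by (intro R_ge_power) simp
  hence "13 * (real q ^ (k - t + 1 + (k + 1)) * B 1) \<le> B 0"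
    using mult_B_le[OF _ R_B1 B_nonneg, of 13] by simp
  thus ?thesis using 1 B_pos[of 0] by linarith
qed

text \<open>\<open>\<F>\<close> splits into spaces meeting \<open>X\<close> in more than
  \<open>E\<close>, at most \<open>A1\<close> many, and the exceptional set \<open>D\<close>;
  \<open>\<G>\<close> splits into spaces through \<open>E\<close> and the set \<open>\<B>\<close>
  inside \<open>X\<close>. Equality forces each of these four parts to have its maximal
  size.\<close>

lemma star_bound:
  assumes P: "almost_cross \<F> \<G>" and S: "star_like \<F> \<G> X E"
  shows "real (card \<F>) * real (card \<G>) \<le> G1"
    and "G1 \<le> real (card \<F>) * real (card \<G>) \<Longrightarrow> star_extremal \<F> \<G> \<and> card \<F> < card \<G>"
proof -
  let ?H1 = "H1 scale UNIV E k" and ?H2 = "H2 scale X E k"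
  let ?Qn = "real q ^ (k - t + 1) * qint q t"
  define D where "D = {A \<in> \<F>. A \<inter> X = E}"
  define \<B> where "\<B> = {A \<in> \<G>. \<not> E \<subseteq> A}"
  have X: "subspace X" "dim X = k + 1" and E: "subspace E" "dim E = t" "E \<subseteq> X"
    and FE: "\<And>A. A \<in> \<F> \<Longrightarrow> E \<subseteq> A" and \<B>X: "\<And>A. A \<in> \<G> \<Longrightarrow> \<not> E \<subseteq> A \<Longrightarrow> A \<subseteq> X"
    and D: "card D \<le> s" "D = {} \<or> card \<B> \<le> s"
    using S by (auto simp: star_like_def D_def \<B>_def)
  have Gr: "\<F> \<subseteq> Gr" "\<G> \<subseteq> Gr" using P by (auto simp: almost_cross_def)
  have H21: "?H2 \<subseteq> ?H1" by (auto simp: H1_def H2_def)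
  have cH1: "real (card ?H1) = B 0" using card_H1[OF E(1), of 0] E(2) k_ge by simp
  have cH2: "real (card ?H2) = B 0 - A1"
    using card_H2[OF E(1) X(1) E(3), of k] E(2) X(2) k_ge dim_V by (simp add: A1_def)
  have cdiff: "real (card (?H1 - ?H2)) = A1"
    using card_Diff_subset[OF finite_families H21] card_mono[OF finite_families H21] cH1 cH2
    by (simp add: of_nat_diff)
  have Fsub: "\<F> \<subseteq> (?H1 - ?H2) \<union> D"
    using Gr(1) FE by (auto simp: H1_def H2_def D_def)
  have "card \<F> \<le> card ((?H1 - ?H2) \<union> D)" by (rule card_mono[OF finite_families Fsub])
  also have "\<dots> \<le> card (?H1 - ?H2) + card D" by (rule card_Un_le)
  finally have cF: "real (card \<F>) \<le> A1 + real (card D)" using cdiff by linarith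
  have Geq: "\<G> = above \<G> E \<union> \<B>" by (auto simp: above_def \<B>_def)
  have above_sub: "above \<G> E \<subseteq> ?H1" using Gr(2) by (auto simp: above_def H1_def)
  have c_above: "real (card (above \<G> E)) \<le> B 0"
    using card_mono[OF finite_families above_sub] cH1 by linarith
  have "card (above \<G> E \<union> \<B>) \<le> card (above \<G> E) + card \<B>" by (rule card_Un_le)
  hence cG': "card \<G> \<le> card (above \<G> E) + card \<B>" using Geq by argo
  hence cG: "real (card \<G>) \<le> B 0 + real (card \<B>)" using c_above by linarith
  have \<B>sub: "\<B> \<subseteq> subspaces_of_dim scale X k - H1 scale X E k"
  proof
    fix A assume "A \<in> \<B>"
    hence A: "A \<in> \<G>" "\<not> E \<subseteq> A" by (auto simp: \<B>_def)
    show "A \<in> subspaces_of_dim scale X k - H1 scale X E k"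
      using subsetD[OF Gr(2) A(1)] \<B>X[OF A] A(2) by (simp add: H1_def)
  qed
  \<comment> \<open>The members of \<open>\<B>\<close> are k-subspaces of \<open>X\<close> not
    through \<open>E\<close>, and of these there are
    \<open>qint q (k + 1) - qint q (k - t + 1)\<close>.\<close>
  have c\<B>: "real (card \<B>) \<le> ?Qn"
  proof -
    have sub: "H1 scale X E k \<subseteq> subspaces_of_dim scale X k" by (auto simp: H1_def)
    have "real (card (H1 scale X E k)) = gb q (Suc (k - t)) (k - t)"
      using card_subspaces_above[OF E(1) X(1) E(3), of k] E(2) X(2) k_ge
      by (simp add: H1_def Suc_diff_le)
    moreover have "real (card (subspaces_of_dim scale X k)) = gb q (Suc k) k"
      using card_subspaces_of_dim[OF X(1), of k] X(2) by simp
    moreover have "real (card (subspaces_of_dim scale X k - H1 scale X E k))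
        = real (card (subspaces_of_dim scale X k)) - real (card (H1 scale X E k))"
      using card_Diff_subset[OF finite_families sub] card_mono[OF finite_families sub]
      by (simp add: of_nat_diff)
    ultimately have "real (card (subspaces_of_dim scale X k - H1 scale X E k))
        = qint q (Suc k) - qint q (Suc (k - t))"
      by (simp only: gb_Suc_self[OF real_q_gt_1])
    also have "\<dots> = ?Qn"
    proof -
      have "real q ^ Suc k = real q ^ Suc (k - t) * real q ^ t" using k_ge by (simp flip: power_add)
      thus ?thesis by (simp add: qint_def right_diff_distrib flip: diff_divide_distrib)
    qed
    finally show ?thesis using card_mono[OF finite_families \<B>sub] by linarith
  qed
  have strict: "real (card \<F>) * real (card \<G>) < G1" if "D = {}"
  proof -
    have "real (card \<F>) * real (card \<G>) \<le> A1 * (B 0 + ?Qn)"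
      using cF cG c\<B> that A1_nonneg by (intro mult_mono) auto
    also have "\<dots> = A1 * B 0 + A1 * ?Qn" by (rule distrib_left)
    also have "\<dots> < A1 * B 0 + real s * B 0"
      using A1_mult_less mult_right_mono[OF s_ge_1 B_nonneg[of 0]] by linarith
    also have "\<dots> = (A1 + real s) * B 0" by (rule distrib_right[symmetric])
    also have "\<dots> \<le> G1" unfolding G1_def using min_nonneg A1_nonneg by (intro mult_left_mono) auto
    finally show ?thesis .
  qed
  have F: "real (card \<F>) \<le> A1 + real s" using cF D(1) by linarith
  have cmin: "real (card \<B>) \<le> min (real s) ?Qn" if "D \<noteq> {}" using c\<B> D(2) that by auto
  hence G: "real (card \<G>) \<le> B 0 + min (real s) ?Qn" if "D \<noteq> {}" using cG that by fastforce
  show "real (card \<F>) * real (card \<G>) \<le> G1"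
  proof (cases "D = {}")
    case False
    show ?thesis unfolding G1_def using F G[OF False] A1_nonneg by (intro mult_mono) auto
  qed (use strict in simp)
  assume le: "G1 \<le> real (card \<F>) * real (card \<G>)"
  hence Dne: "D \<noteq> {}" using strict by fastforce
  have pos: "0 < A1 + real s" "0 < B 0 + min (real s) ?Qn"
    using A1_nonneg s_ge_1 B_pos[of 0] min_nonneg by linarith+
  have eq: "real (card \<F>) = A1 + real s" "real (card \<G>) = B 0 + min (real s) ?Qn"
    by (rule mult_eq_imp_eq[OF of_nat_0_le_iff F of_nat_0_le_iff G[OF Dne] pos le[unfolded G1_def]])+
  have "card ((?H1 - ?H2) \<union> D) \<le> card (?H1 - ?H2) + card D" by (rule card_Un_le)
  hence "real (card ((?H1 - ?H2) \<union> D)) \<le> A1 + real s" using cdiff D(1) by linarith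
  hence "card ((?H1 - ?H2) \<union> D) \<le> card \<F>" using eq(1) by linarith
  hence Feq: "\<F> = (?H1 - ?H2) \<union> D" by (rule card_seteq[OF finite_families Fsub])
  have FH1: "\<F> \<subseteq> ?H1" using Gr(1) FE by (auto simp: H1_def)
  define \<A> where "\<A> = ?H1 - \<F>"
  have "\<F> = ?H1 - \<A>" using FH1 by (auto simp: \<A>_def)
  moreover have "\<A> \<subseteq> ?H2" using Feq by (auto simp: \<A>_def)
  moreover have "real (card \<A>) = B 0 - A1 - real s"
    unfolding \<A>_def using card_Diff_subset[OF finite_families FH1] card_mono[OF finite_families FH1] cH1 eq(1)
    by (simp add: of_nat_diff)
  hence "real (card \<A>) = real q ^ ((k - t) * (k - t + 1)) * gb q (n - k - 1) (k - t) - real s"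
    using k_ge by (simp add: A1_def Suc_diff_le)
  moreover have c\<B>eq: "real (card \<B>) = min (real s) ?Qn" "real (card (above \<G> E)) = B 0"
    using eq(2) cG' c_above cmin[OF Dne] by linarith+
  moreover have "above \<G> E = ?H1"
    by (rule card_seteq[OF finite_families above_sub]) (use c\<B>eq cH1 in linarith)
  hence "\<G> = ?H1 \<union> \<B>" using Geq by argo
  moreover have "X \<in> subspaces_of_dim scale UNIV (k + 1)" "E \<in> subspaces_of_dim scale X t"
    using X E by auto
  ultimately have "star_extremal \<F> \<G>" unfolding star_extremal_def using \<B>sub by blast
  moreover have "card \<F> < card \<G>"
  proof -
    have "A1 + real s < B 0" using A1_upper cB1_small s_small B1_small B_pos[of 0] by linarith
    thus ?thesis using eq min_nonneg by linarith
  qed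
  ultimately show "star_extremal \<F> \<G> \<and> card \<F> < card \<G>" by blast
qed

section \<open>Assembly of the cases for a nontrivial pair\<close>

lemma is_cover_0_iff:
  assumes "\<F> \<subseteq> Gr"
  shows "is_cover \<F> 0 \<longleftrightarrow> (\<exists>E. subspace E \<and> dim E = t \<and> (\<forall>A\<in>\<F>. E \<subseteq> A))"
proof
  assume "is_cover \<F> 0"
  then obtain E where E: "subspace E" "dim E = t" "\<forall>A\<in>\<F>. t \<le> dim (A \<inter> E)" by (auto simp: is_cover_def)
  have "E \<subseteq> A" if "A \<in> \<F>" for A
    using dim_Int_less[OF E(1,2), of A] assms that E(3) by (force simp: Int_commute)
  thus "\<exists>E. subspace E \<and> dim E = t \<and> (\<forall>A\<in>\<F>. E \<subseteq> A)" using E by blast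
next
  assume "\<exists>E. subspace E \<and> dim E = t \<and> (\<forall>A\<in>\<F>. E \<subseteq> A)"
  then obtain E where E: "subspace E" "dim E = t" "\<forall>A\<in>\<F>. E \<subseteq> A" by blast
  hence "A \<inter> E = E" if "A \<in> \<F>" for A using that by blast
  thus "is_cover \<F> 0" unfolding is_cover_def using E by auto
qed

text \<open>The clause \<open>card \<F> < card \<G>\<close> fixes the order of the families: when
  the analysis applies with their roles exchanged, it contradicts
  \<open>card \<F> \<le> card \<G>\<close> and excludes equality.\<close>

definition below_or_extremal :: "'b set set \<Rightarrow> 'b set set \<Rightarrow> bool" where
  "below_or_extremal \<F> \<G> \<longleftrightarrow>
     (k \<le> 2 * t \<longrightarrow> real (card \<F>) * real (card \<G>) < G2 \<or>
        real (card \<F>) * real (card \<G>) = G2 \<and> card \<F> < card \<G> \<and>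
        (\<exists>L\<in>subspaces_of_dim scale UNIV (t + 1). \<F> = H1 scale UNIV L k \<and> \<G> = M_fam scale L k t)) \<and>
     (2 * t + 1 \<le> k \<longrightarrow> real (card \<F>) * real (card \<G>) < G1 \<or>
        real (card \<F>) * real (card \<G>) = G1 \<and> card \<F> < card \<G> \<and> star_extremal \<F> \<G>)"

lemma small_below: "small \<F> \<G> \<Longrightarrow> below_or_extremal \<F> \<G>"
  unfolding below_or_extremal_def using small_less_G1 small_less_G2 by blast

lemma below_or_extremal_of_cover:
  assumes P: "almost_cross \<F> \<G>" and kt: "(k, t) \<noteq> (4, 2)" and nonempty: "\<F> \<noteq> {}"
    and cov: "is_cover \<F> 0" "\<not> is_cover \<G> 0"
  shows "below_or_extremal \<F> \<G>"
proof -
  have "\<F> \<subseteq> Gr" using P by (simp add: almost_cross_def)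
  then obtain E where E: "subspace E" "dim E = t" "\<And>A. A \<in> \<F> \<Longrightarrow> E \<subseteq> A"
    using cov(1) is_cover_0_iff[of \<F>] by blast
  show ?thesis
  proof (rule almost_cross_cases[OF P E nonempty cov(2)])
    assume "small \<F> \<G>"
    thus ?thesis by (rule small_below)
  next
    fix L assume L: "subspace L" "dim L = t + 1" "\<And>A. A \<in> \<F> \<Longrightarrow> L \<subseteq> A"
      "\<And>A. A \<in> \<G> \<Longrightarrow> t \<le> dim (A \<inter> L)"
    have Lmem: "L \<in> subspaces_of_dim scale UNIV (t + 1)" using L(1,2) by simp
    have bound: "real (card \<F>) * real (card \<G>) \<le> G2" by (rule flag_bound(1)[OF P L])
    have eq: "\<F> = H1 scale UNIV L k \<and> \<G> = M_fam scale L k t \<and> card \<F> < card \<G>"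
      if "G2 \<le> real (card \<F>) * real (card \<G>)"
      by (rule flag_bound(2)[OF P L that])
    show ?thesis unfolding below_or_extremal_def
    proof (intro conjI impI)
      show "real (card \<F>) * real (card \<G>) < G2 \<or>
        real (card \<F>) * real (card \<G>) = G2 \<and> card \<F> < card \<G> \<and>
        (\<exists>L\<in>subspaces_of_dim scale UNIV (t + 1). \<F> = H1 scale UNIV L k \<and> \<G> = M_fam scale L k t)"
      proof (cases "G2 \<le> real (card \<F>) * real (card \<G>)")
        case True
        hence "real (card \<F>) * real (card \<G>) = G2" using bound by linarith
        thus ?thesis using eq[OF True] Lmem by blast
      qed simp
      show "real (card \<F>) * real (card \<G>) < G1 \<or>
        real (card \<F>) * real (card \<G>) = G1 \<and> card \<F> < card \<G> \<and> star_extremal \<F> \<G>"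
        if "2 * t + 1 \<le> k"
        using bound G2_less_G1[OF that] by linarith
    qed
  next
    fix X assume S: "star_like \<F> \<G> X E"
    note bound = star_bound[OF P S]
    show ?thesis unfolding below_or_extremal_def
    proof (intro conjI impI)
      show "real (card \<F>) * real (card \<G>) < G2 \<or>
        real (card \<F>) * real (card \<G>) = G2 \<and> card \<F> < card \<G> \<and>
        (\<exists>L\<in>subspaces_of_dim scale UNIV (t + 1). \<F> = H1 scale UNIV L k \<and> \<G> = M_fam scale L k t)"
        if "k \<le> 2 * t"
        using bound(1) G1_less_G2[OF that kt] by linarith
      show "real (card \<F>) * real (card \<G>) < G1 \<or>
        real (card \<F>) * real (card \<G>) = G1 \<and> card \<F> < card \<G> \<and> star_extremal \<F> \<G>"
      proof (cases "G1 \<le> real (card \<F>) * real (card \<G>)")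
        case True
        hence "real (card \<F>) * real (card \<G>) = G1" using bound(1) by linarith
        thus ?thesis using bound(2)[OF True] by blast
      qed simp
    qed
  qed
qed

lemma below_or_extremal_pair:
  assumes P: "almost_cross \<F> \<G>" and kt: "(k, t) \<noteq> (4, 2)" and le: "card \<F> \<le> card \<G>"
    and nontriv: "\<And>E. subspace E \<Longrightarrow> dim E = t \<Longrightarrow> \<exists>A\<in>\<F> \<union> \<G>. \<not> E \<subseteq> A"
  shows "below_or_extremal \<F> \<G>"
proof (cases "\<F> = {} \<or> \<G> = {}")
  case True
  hence "small \<F> \<G>" using main_coeff_ge_1 BB_pos by (auto simp: small_def)
  thus ?thesis by (rule small_below)
next
  case False
  hence ne: "\<F> \<noteq> {}" "\<G> \<noteq> {}" by auto
  have Gr: "\<F> \<subseteq> Gr" "\<G> \<subseteq> Gr" using P by (auto simp: almost_cross_def)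
  show ?thesis
  proof (cases "is_cover \<F> 0")
    case F: True
    show ?thesis
    proof (cases "is_cover \<G> 0")
      case True
      obtain E where E: "subspace E" "dim E = t" "\<And>A. A \<in> \<F> \<Longrightarrow> E \<subseteq> A"
        using F is_cover_0_iff[OF Gr(1)] by blast
      obtain E' where E': "subspace E'" "dim E' = t" "\<And>A. A \<in> \<G> \<Longrightarrow> E' \<subseteq> A"
        using True is_cover_0_iff[OF Gr(2)] by blast
      have "\<exists>A\<in>\<G>. \<not> E \<subseteq> A" using nontriv[OF E(1,2)] E(3) by blast
      moreover have "\<exists>A\<in>\<F>. \<not> E' \<subseteq> A" using nontriv[OF E'(1,2)] E'(3) by blast
      ultimately show ?thesis using small_below both_covered_small[OF P E _ E'] by blast
    qed (rule below_or_extremal_of_cover[OF P kt ne(1) F])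
  next
    case F: False
    show ?thesis
    proof (cases "is_cover \<G> 0")
      case True
      have "below_or_extremal \<G> \<F>" by (rule below_or_extremal_of_cover[OF almost_cross_sym[OF P] kt ne(2) True F])
      thus ?thesis using le unfolding below_or_extremal_def by (simp add: mult.commute)
    next
      case False
      thus ?thesis using small_below both_uncovered_small[OF P ne F] by blast
    qed
  qed
qed

section \<open>Translation into the Gaussian binomials of the statement\<close>

lemma gauss_binomial_diff:
  assumes "i \<le> n" "j \<le> k" "k - j \<le> n - i"
  shows "gauss_binomial q (int n - int i) (int k - int j) = gb q (n - i) (k - j)"
  using gauss_binomial_eq_gb[OF assms(3), of q] assms by (simp add: of_nat_diff)

lemma gauss_binomial_t:
  "gauss_binomial q (int t) 1 = qint q t" "gauss_binomial q (int t + 1) 1 = qint q (t + 1)"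
  using gauss_binomial_eq_gb[of 1 t q] gauss_binomial_eq_gb[of 1 "t + 1" q] t_pos
  by (simp_all add: gb_1 add.commute)

lemma gauss_binomial_H2:
  "gauss_binomial q (int n - int k - 1) (int k - int t) = gb q (n - k - 1) (k - t)"
  using gauss_binomial_diff[of "k + 1" t] k_ge n_large by (simp add: algebra_simps)

lemma g1_eq: "g1 q n k t s = G1"
  using gauss_binomial_diff[of t t] gauss_binomial_H2 k_ge n_large
  by (simp add: g1_def G1_def A1_def B_def gauss_binomial_t)

lemma g2_eq: "g2 q n k t = G2"
proof -
  have "gauss_binomial q (int n - int t - 1) (int k - int t - 1) = B 1"
    "gauss_binomial q (int n - int t - 1) (int k - int t) = gb q (n - t - 1) (k - t)"
    using gauss_binomial_diff[of "t + 1" "t + 1"] gauss_binomial_diff[of "t + 1" t] k_ge n_large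
    by (simp_all add: B_def algebra_simps)
  thus ?thesis unfolding g2_def G2_def gauss_binomial_t B0_eq by (simp add: algebra_simps power2_eq_square)
qed

end

theorem theorem1p2:
  fixes scale :: "'a::{field,finite} \<Rightarrow> 'b::ab_group_add \<Rightarrow> 'b"
    and q n k t s :: nat
    and \<F> \<G> :: "'b set set"
  assumes "vector_space scale"
    and "q = CARD('a)"
    and "vector_space.dim scale (UNIV :: 'b set) = n"
    and "n > 0" and "k > 0" and "t > 0" and "s > 0"
    and "(k, t) \<noteq> (4, 2)"
    and "k \<ge> t + 2"
    and "real n \<ge> 3 * real k + 3 * real t + 1 + log (real q) (13 * real s)"
    and "almost_cross_intersecting scale k t s \<F> \<G>"
    and "nontrivial_pair scale t \<F> \<G>"
    and "\<And>\<F>' \<G>'. almost_cross_intersecting scale k t s \<F>' \<G>' \<Longrightarrow> nontrivial_pair scale t \<F>' \<G>'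
           \<Longrightarrow> card \<F>' * card \<G>' \<le> card \<F> * card \<G>"
    and "card \<F> \<le> card \<G>"
  shows "(k \<le> 2 * t \<longrightarrow>
            real (card \<F> * card \<G>) \<le> g2 q n k t \<and>
            (real (card \<F> * card \<G>) = g2 q n k t \<longrightarrow>
               (\<exists>L\<in>subspaces_of_dim scale UNIV (t + 1).
                  \<F> = H1 scale UNIV L k \<and> \<G> = M_fam scale L k t))) \<and>
         (2 * t + 1 \<le> k \<longrightarrow>
            real (card \<F> * card \<G>) \<le> g1 q n k t s \<and>
            (real (card \<F> * card \<G>) = g1 q n k t s \<longrightarrow>
               (\<exists>X\<in>subspaces_of_dim scale UNIV (k + 1). \<exists>E\<in>subspaces_of_dim scale X t.
                  \<exists>\<A> \<B>.
                    \<F> = H1 scale UNIV E k - \<A> \<and>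
                    \<G> = H1 scale UNIV E k \<union> \<B> \<and>
                    \<A> \<subseteq> H2 scale X E k \<and>
                    \<B> \<subseteq> subspaces_of_dim scale X k - H1 scale X E k \<and>
                    real (card \<A>) =
                      real q ^ ((k - t) * (k - t + 1))
                        * gauss_binomial q (int n - int k - 1) (int k - int t) - real s \<and>
                    real (card \<B>) =
                      min (real s) (real q ^ (k - t + 1) * gauss_binomial q (int t) 1))))"
proof -
  interpret vs: vector_space scale by (rule assms(1))
  obtain Basis where Basis: "vs.independent Basis" "UNIV \<subseteq> vs.span Basis" "card Basis = n"
    using vs.basis_exists[of UNIV] assms(3) by metis
  \<comment> \<open>An infinite set has \<open>card\<close> 0, so \<open>n > 0\<close> yields
    finiteness of the basis.\<close>
  have "finite Basis" using Basis(3) assms(4) by (intro card_ge_0_finite) simp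
  then interpret V: finite_field_vector_space scale Basis q
    using Basis assms(2) by unfold_locales auto
  interpret V: almost_cross_setting scale Basis q n k t s
  proof
    have q1: "1 < real q" by (rule V.real_q_gt_1)
    have "13 * real s = real q powr log (real q) (13 * real s)"
      using q1 assms(7) by (intro powr_log_cancel[symmetric]) auto
    hence "13 * real s * real q powr real (3 * k + 3 * t + 1)
        = real q powr (log (real q) (13 * real s) + real (3 * k + 3 * t + 1))"
      by (simp only: powr_add)
    also have "\<dots> \<le> real q powr real n" using q1 assms(10) by (intro powr_mono) auto
    finally show "13 * real s * real q ^ (3 * k + 3 * t + 1) \<le> real q ^ n"
      using q1 by (simp only: powr_realpow)
  qed (use assms in simp_all)
  have "V.almost_cross \<F> \<G>"
    using assms(11) by (auto simp: almost_cross_intersecting_def V.almost_cross_def)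
  moreover have "\<exists>A\<in>\<F> \<union> \<G>. \<not> E \<subseteq> A" if E: "vs.subspace E" "vs.dim E = t" for E
  proof (rule ccontr)
    assume "\<not> (\<exists>A\<in>\<F> \<union> \<G>. \<not> E \<subseteq> A)"
    hence "E \<subseteq> \<Inter>(\<F> \<union> \<G>)" by blast
    hence "vs.dim E \<le> vs.dim (\<Inter>(\<F> \<union> \<G>))" by (rule V.dim_subset)
    thus False using E(2) assms(12) by (simp add: nontrivial_pair_def)
  qed
  ultimately have *: "V.below_or_extremal \<F> \<G>"
    by (rule V.below_or_extremal_pair[OF _ assms(8) assms(14)])
  have prod: "real (card \<F> * card \<G>) = real (card \<F>) * real (card \<G>)" by simp
  have le_if: "x \<le> y \<and> (x = y \<longrightarrow> S)" if "x < y \<or> x = y \<and> Q \<and> S" for x y :: real and Q S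
    using that by auto
  note ** = *[unfolded V.below_or_extremal_def V.star_extremal_def]
  show ?thesis
    unfolding V.g1_eq V.g2_eq V.gauss_binomial_H2 V.gauss_binomial_t prod
  proof (rule conjI; rule impI; rule le_if)
    assume "k \<le> 2 * t"
    thus "real (card \<F>) * real (card \<G>) < V.G2 \<or>
        real (card \<F>) * real (card \<G>) = V.G2 \<and> card \<F> < card \<G> \<and>
        (\<exists>L\<in>subspaces_of_dim scale UNIV (t + 1). \<F> = H1 scale UNIV L k \<and> \<G> = M_fam scale L k t)"
      by (rule conjunct1[OF **, THEN mp])
  qed (rule conjunct2[OF **, THEN mp])
qed

end
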